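(* Suppose the ellipticity assumption holds on $U$ and $|b(x)|\le M_2$ for all $x\in U$ with a constant $M_2\ge0$. There exist constants $C_*>0$, $\nu>0$ and $K_1>0$, independent of $u_1,u_2,f_1,f_2$, such that the following holds. Let $f_1,f_2:U\to\mathbb R$ be bounded in $U$, and let $u_1,u_2\in C^2(U)\cap C(\widetilde U)$ be below exponential growth in $\widetilde U$ and bounded on $\gamma$, with $Lu_1=f_1$ and $Lu_2=f_2$ in $U$. Then $$\max_{x\in \mathcal S_{\theta}}|u_1(x)-u_2(x)|\le (1+C_* )\sup_{x\in \gamma}|u_1(x)-u_2(x)| +K_1(1+C_* ) \sup_{x\in U}|f_1(x)-f_2(x)| + C_*\Big( \max_{x\in \mathcal S_{\theta_0}}|u_1(x)-u_2(x)|\Big)e^{-\nu(\theta-\theta_0)}$$ for all $\theta\ge\theta_0$, and $$\limsup_{\theta\to\infty}\Big(\max_{x\in \mathcal S_{\theta}}|u_1(x)-u_2(x)|\Big)\le \limsup_{\theta\to\infty}\Big(\sup_{x\in \gamma\cap \mathcal S_\theta}|u_1(x)-u_2(x)|\Big)+K_1 \limsup_{\theta\to\infty}\Big(\sup_{x\in U\cap \mathcal S_\theta}|f_1(x)-f_2(x)|\Big).$$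
   Context: Domain. Let $X(r,\theta)=(r\cos\theta,r\sin\theta)$ for $r\ge0$, $\theta\in\mathbb R$. Fix $\theta_0\in\mathbb R$ and positive continuous functions $r_1,r_2$ on $[\theta_0,\infty)$ with $r_2(\theta+2\pi)<r_1(\theta)<r_2(\theta)$ for all $\theta\ge\theta_0$, and assume there is $r_*>0$ with $\lim_{\theta\to\infty}r_1(\theta)=\lim_{\theta\to\infty}r_2(\theta)=r_*$. Define $U=\{X(r,\theta):\theta>\theta_0,\ r_1(\theta)<r<r_2(\theta)\}$ (open and bounded), $\widetilde U=\{X(r,\theta):\theta\ge\theta_0,\ r_1(\theta)\le r\le r_2(\theta)\}$, $\gamma=\{X(r_i(\theta),\theta):\theta\ge\theta_0,\ i=1,2\}$, and $\mathcal S_\theta=\{X(r,\theta): r_1(\theta)\le r\le r_2(\theta)\}$ for $\theta\ge\theta_0$. Operator. $A=(a_{ij})$ is a function from $U$ to the real symmetric $2\times2$ matrices, $b:U\to\mathbb R^2$, and $Lu=-\sum_{i,j=1}^2 a_{ij}\frac{\partial^2u}{\partial x_i\partial x_j}+b\cdot\nabla u$ for $u\in C^2(U)$. Ellipticity assumption on $U$: there are constants $c_0>0$, $M_1>0$ such that $\xi^{\rm T}A(x)\xi\ge c_0|\xi|^2$ and $\mathrm{Tr}(A(x))\le M_1$ for all $x\in U$, $\xi\in\mathbb R^2$. A function $u:\widetilde U\to\mathbb R$ is below exponential growth in $\widetilde U$ if for any $\varepsilon>0$, $\lim_{\theta\to\infty}\big(e^{-\varepsilon\theta}\sup_{x\in\mathcal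 S_\theta}|u(x)|\big)=0$. *)

theory Defs
  imports "HOL-Analysis.Analysis"
begin

definition polar :: "real \<Rightarrow> real \<Rightarrow> real^2" where
  "polar r \<theta> = vector [r * cos \<theta>, r * sin \<theta>]"

definition spiral_domain :: "real \<Rightarrow> (real \<Rightarrow> real) \<Rightarrow> (real \<Rightarrow> real) \<Rightarrow> (real^2) set" where
  "spiral_domain \<theta>0 r1 r2 = {polar r \<theta> | r \<theta>. \<theta>0 < \<theta> \<and> r1 \<theta> < r \<and> r < r2 \<theta>}"

text \<open>Unlike the topological closure of the open spiral, this set does not contain the
  limit circle.\<close>
definition spiral_closed :: "real \<Rightarrow> (real \<Rightarrow> real) \<Rightarrow> (real \<Rightarrow> real) \<Rightarrow> (real^2) set" where
  "spiral_closed \<theta>0 r1 r2 = {polar r \<theta> | r \<theta>. \<theta>0 \<le> \<theta> \<and> r1 \<theta> \<le> r \<and> r \<le> r2 \<theta>}"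

text \<open>The two lateral curves only; the interior of the initial segment at angle
  \<open>\<theta>0\<close> is not part of this set.\<close>
definition spiral_sides :: "real \<Rightarrow> (real \<Rightarrow> real) \<Rightarrow> (real \<Rightarrow> real) \<Rightarrow> (real^2) set" where
  "spiral_sides \<theta>0 r1 r2 = {polar (\<rho> \<theta>) \<theta> | \<rho> \<theta>. \<rho> \<in> {r1, r2} \<and> \<theta>0 \<le> \<theta>}"

definition spiral_section :: "(real \<Rightarrow> real) \<Rightarrow> (real \<Rightarrow> real) \<Rightarrow> real \<Rightarrow> (real^2) set" where
  "spiral_section r1 r2 \<theta> = {polar r \<theta> | r. r1 \<theta> \<le> r \<and> r \<le> r2 \<theta>}"

definition partial_deriv :: "'n::finite \<Rightarrow> (real^'n \<Rightarrow> real) \<Rightarrow> real^'n \<Rightarrow> real" where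
  "partial_deriv i u x = deriv (\<lambda>t. u (x + t *\<^sub>R axis i 1)) 0"

definition gradient :: "(real^'n::finite \<Rightarrow> real) \<Rightarrow> real^'n \<Rightarrow> real^'n" where
  "gradient u x = (\<chi> i. partial_deriv i u x)"

text \<open>The classes \<open>C\<^sup>1\<close> and \<open>C\<^sup>2\<close>, meant for open sets \<open>S\<close>. Differentiability is required
  explicitly, since \<^const>\<open>deriv\<close> is a total function.\<close>
definition C1_on :: "(real^'n::finite) set \<Rightarrow> (real^'n \<Rightarrow> real) \<Rightarrow> bool" where
  "C1_on S u \<longleftrightarrow> continuous_on S u \<and>
     (\<forall>i. (\<forall>x\<in>S. (\<lambda>t. u (x + t *\<^sub>R axis i 1)) field_differentiable at 0) \<and>
          continuous_on S (partial_deriv i u))"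

definition C2_on :: "(real^'n::finite) set \<Rightarrow> (real^'n \<Rightarrow> real) \<Rightarrow> bool" where
  "C2_on S u \<longleftrightarrow> C1_on S u \<and> (\<forall>i. C1_on S (partial_deriv i u))"

definition elliptic_op ::
  "(real^2 \<Rightarrow> real^2^2) \<Rightarrow> (real^2 \<Rightarrow> real^2) \<Rightarrow> (real^2 \<Rightarrow> real) \<Rightarrow> real^2 \<Rightarrow> real" where
  "elliptic_op A b u x =
     - (\<Sum>i\<in>UNIV. \<Sum>j\<in>UNIV. A x $ i $ j * partial_deriv i (partial_deriv j u) x)
     + b x \<bullet> gradient u x"

text \<open>The supremum is a real supremum, hence meaningful when \<open>u\<close> is bounded on every section,
  in particular when \<open>u\<close> is continuous on the closed spiral (sections are compact).\<close>
definition below_exp_growth ::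
  "(real \<Rightarrow> real) \<Rightarrow> (real \<Rightarrow> real) \<Rightarrow> (real^2 \<Rightarrow> real) \<Rightarrow> bool" where
  "below_exp_growth r1 r2 u \<longleftrightarrow>
     (\<forall>\<epsilon>>0. ((\<lambda>\<theta>. exp (- \<epsilon> * \<theta>) * (SUP x\<in>spiral_section r1 r2 \<theta>. \<bar>u x\<bar>)) \<longlongrightarrow> 0) at_top)"

end

theory Submission
  imports Defs
begin

text \<open>
  The estimate is a maximum principle with an explicit barrier.  In polar coordinates consider
  \<open>w\<^sub>\<mu>(r, \<theta>) = e\<^sup>\<mu>\<^sup>\<theta> h(r)\<close> with \<open>h(r) = 2 - e\<^bsup>\<alpha>(r - R)\<^esup>\<close>, where \<open>R\<close> bounds the radii; then
  \<open>1 \<le> h \<le> 2\<close>.  For \<open>\<mu> = 0\<close> and \<open>\<alpha>\<close> large the concavity of \<open>h\<close> dominates the drift, so that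
  \<open>L h\<close> is bounded below by a positive constant; the angular factor perturbs this by at most a
  multiple of \<open>\<bar>\<mu>\<bar> e\<^sup>\<mu>\<^sup>\<theta>\<close>, hence for some \<open>\<delta>, \<nu> > 0\<close> one has \<open>L w\<^sub>\<mu> \<ge> \<delta> e\<^sup>\<mu>\<^sup>\<theta>\<close> whenever \<open>\<bar>\<mu>\<bar> \<le> \<nu>\<close>
  (\<open>barrier_strict_supersolution\<close>).

  Let \<open>m\<close>, \<open>F\<close> and \<open>n\<close> bound the difference of the solutions on the sides, the difference of the
  right-hand sides, and the difference of the solutions on the section at angle \<open>T\<close>. The function
  \<open>W = m + (F/\<delta>) w\<^sub>0 + n e\<^sup>\<nu>\<^sup>T w\<^sub>-\<^sub>\<nu> + 2\<epsilon> w\<^sub>\<nu>\<close>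
  dominates the difference on the sides (first term), on the initial section (third term) and, by
  the growth condition, on all sufficiently remote sections (last term), while \<open>L W > F\<close> because
  the last term makes the inequality strict.  On the compact part of the spiral between two
  sections a positive maximum of the difference minus \<open>W\<close> would therefore be interior, and there
  the second derivative test contradicts \<open>L W > F\<close> (\<open>comparison\<close>, \<open>touching_from_above\<close>).
  Letting \<open>\<epsilon> \<rightarrow> 0\<close> gives
  \<open>m + (2/\<delta>) F + 2 n e\<^bsup>- \<nu>(\<theta> - T)\<^esup>\<close> as a bound (\<open>one_sided_estimate\<close>).

  With \<open>T = \<theta>\<^sub>0\<close> this is stronger than the first claim with \<open>C = 2\<close> and \<open>K\<^sub>1 = 2/\<delta>\<close>.
  For the second claim start at a large \<open>T\<close>, where \<open>m\<close> and \<open>F\<close> may be taken arbitrarily close to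
  the upper limits, and let \<open>\<theta> \<rightarrow> \<infinity>\<close>, which removes the term with \<open>n\<close>.

  The angle is not a function on the plane.  All derivatives are therefore taken along straight
  lines through one point, on which radius and angle are explicit functions of one real parameter;
  no change of variables in the operator is performed.
\<close>

section \<open>Second order jets of functions of one variable\<close>

text \<open>The value of the function at 0 is not recorded: \<open>p\<close> and \<open>q\<close> are its first and second
  derivatives at 0.\<close>
definition jet2 :: "(real \<Rightarrow> real) \<Rightarrow> real \<Rightarrow> real \<Rightarrow> bool" where
  "jet2 \<phi> p q \<longleftrightarrow> (\<exists>D. (\<forall>\<^sub>F t in nhds 0. (\<phi> has_real_derivative D t) (at t)) \<and> D 0 = p \<and>
     (D has_real_derivative q) (at 0))"

lemma jet2I:
  assumes "\<forall>\<^sub>F t in nhds 0. (\<phi> has_real_derivative D t) (at t)" "D 0 = p"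
    and "(D has_real_derivative q) (at 0)"
  shows "jet2 \<phi> p q"
  using assms unfolding jet2_def by blast

lemma jet2_tendsto:
  assumes "jet2 \<phi> p q"
  shows "(\<phi> \<longlongrightarrow> \<phi> 0) (nhds 0)"
proof -
  have "isCont \<phi> 0"
    using assms unfolding jet2_def by (blast dest: eventually_nhds_x_imp_x intro: DERIV_isCont)
  then show ?thesis by (simp add: isCont_def tendsto_at_iff_tendsto_nhds)
qed

lemma jet2_const: "jet2 (\<lambda>_. c) 0 0"
  by (rule jet2I[where D = "\<lambda>_. 0"]) auto

lemma jet2_add:
  assumes "jet2 \<phi> p q" "jet2 \<psi> p' q'"
  shows "jet2 (\<lambda>t. \<phi> t + \<psi> t) (p + p') (q + q')"
proof -
  from assms obtain D E where D: "\<forall>\<^sub>F t in nhds 0. (\<phi> has_real_derivative D t) (at t)" "D 0 = p"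
     "(D has_real_derivative q) (at 0)"
    and E: "\<forall>\<^sub>F t in nhds 0. (\<psi> has_real_derivative E t) (at t)" "E 0 = p'"
     "(E has_real_derivative q') (at 0)"
    unfolding jet2_def by blast
  show ?thesis
  proof (rule jet2I[where D = "\<lambda>t. D t + E t"])
    show "\<forall>\<^sub>F t in nhds 0. ((\<lambda>t. \<phi> t + \<psi> t) has_real_derivative D t + E t) (at t)"
      using D(1) E(1) by eventually_elim (rule DERIV_add)
    show "((\<lambda>t. D t + E t) has_real_derivative q + q') (at 0)"
      by (rule DERIV_add[OF D(3) E(3)])
  qed (simp add: D(2) E(2))
qed

lemma jet2_mult:
  assumes "jet2 \<phi> p q" "jet2 \<psi> p' q'"
  shows "jet2 (\<lambda>t. \<phi> t * \<psi> t) (p * \<psi> 0 + \<phi> 0 * p') (q * \<psi> 0 + 2 * p * p' + \<phi> 0 * q')"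
proof -
  from assms obtain D E where D: "\<forall>\<^sub>F t in nhds 0. (\<phi> has_real_derivative D t) (at t)" "D 0 = p"
     "(D has_real_derivative q) (at 0)"
    and E: "\<forall>\<^sub>F t in nhds 0. (\<psi> has_real_derivative E t) (at t)" "E 0 = p'"
     "(E has_real_derivative q') (at 0)"
    unfolding jet2_def by blast
  note at0 = eventually_nhds_x_imp_x[OF D(1)] eventually_nhds_x_imp_x[OF E(1)]
  show ?thesis
  proof (rule jet2I[where D = "\<lambda>t. D t * \<psi> t + \<phi> t * E t"])
    show "\<forall>\<^sub>F t in nhds 0. ((\<lambda>t. \<phi> t * \<psi> t) has_real_derivative D t * \<psi> t + \<phi> t * E t) (at t)"
      using D(1) E(1) by eventually_elim (auto intro!: derivative_eq_intros)
    show "((\<lambda>t. D t * \<psi> t + \<phi> t * E t) has_real_derivative q * \<psi> 0 + 2 * p * p' + \<phi> 0 * q') (at 0)"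
      using at0 D(2,3) E(2,3) by (auto intro!: derivative_eq_intros)
  qed (simp add: D(2) E(2))
qed

lemma jet2_cmult: "jet2 \<phi> p q \<Longrightarrow> jet2 (\<lambda>t. c * \<phi> t) (c * p) (c * q)"
  using jet2_mult[OF jet2_const[of c]] by simp

lemma jet2_diff:
  assumes "jet2 \<phi> p q" "jet2 \<psi> p' q'"
  shows "jet2 (\<lambda>t. \<phi> t - \<psi> t) (p - p') (q - q')"
  using jet2_add[OF assms(1) jet2_cmult[OF assms(2), of "-1"]] by simp

lemma jet2_exp:
  assumes "jet2 \<phi> p q"
  shows "jet2 (\<lambda>t. exp (\<phi> t)) (exp (\<phi> 0) * p) (exp (\<phi> 0) * (q + p\<^sup>2))"
proof -
  from assms obtain D where D: "\<forall>\<^sub>F t in nhds 0. (\<phi> has_real_derivative D t) (at t)" "D 0 = p"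
     "(D has_real_derivative q) (at 0)"
    unfolding jet2_def by blast
  note at0 = eventually_nhds_x_imp_x[OF D(1)]
  show ?thesis
  proof (rule jet2I[where D = "\<lambda>t. exp (\<phi> t) * D t"])
    show "\<forall>\<^sub>F t in nhds 0. ((\<lambda>t. exp (\<phi> t)) has_real_derivative exp (\<phi> t) * D t) (at t)"
      using D(1) by eventually_elim (auto intro!: derivative_eq_intros)
    show "((\<lambda>t. exp (\<phi> t) * D t) has_real_derivative exp (\<phi> 0) * (q + p\<^sup>2)) (at 0)"
      using at0 D(2,3) by (auto intro!: derivative_eq_intros simp: algebra_simps power2_eq_square)
  qed (simp add: D(2))
qed

lemma jet2_local_max:
  assumes jet: "jet2 \<phi> p q" and max: "\<forall>\<^sub>F t in nhds 0. \<phi> t \<le> \<phi> 0"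
  shows "p = 0" "q \<le> 0"
proof -
  from jet obtain D where D: "\<forall>\<^sub>F t in nhds 0. (\<phi> has_real_derivative D t) (at t)" "D 0 = p"
     "(D has_real_derivative q) (at 0)"
    unfolding jet2_def by blast
  from eventually_conj[OF D(1) max] obtain d where d: "d > 0"
    and *: "\<And>t. \<bar>t\<bar> < d \<Longrightarrow> (\<phi> has_real_derivative D t) (at t) \<and> \<phi> t \<le> \<phi> 0"
    unfolding eventually_nhds_metric dist_real_def by auto
  show p: "p = 0"
    using DERIV_local_max[of \<phi> p 0 d] *[of 0] * d D(2) by auto
  show "q \<le> 0"
  proof (rule ccontr)
    assume "\<not> q \<le> 0"
    then obtain e where e: "e > 0" "\<And>h. h > 0 \<Longrightarrow> h < e \<Longrightarrow> D 0 < D (0 + h)"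
      using DERIV_pos_inc_right[OF D(3)] by auto
    define h where "h = min d e / 2"
    have h: "0 < h" "h < d" "h < e" using d e(1) by (auto simp: h_def)
    \<comment> \<open>The derivative is positive just to the right of 0, so the function increases there.\<close>
    obtain z where "0 < z" "z < h" "\<phi> h - \<phi> 0 = (h - 0) * D z"
      using MVT2[of 0 h \<phi> D] * h by auto
    moreover have "D z > 0" using e(2)[of z] \<open>0 < z\<close> \<open>z < h\<close> h p D(2) by auto
    ultimately have "\<phi> h > \<phi> 0"
      using h by (metis diff_gt_0_iff_gt diff_zero mult_pos_pos)
    with *[of h] h show False by auto
  qed
qed

section \<open>Restrictions of functions of class C2 to lines\<close>

text \<open>Continuity of both partial derivatives upgrades them to a total derivative, which is what
  makes derivatives in oblique directions accessible.\<close>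
lemma C1_on_has_derivative:
  fixes u :: "real^2 \<Rightarrow> real"
  assumes S: "open S" and u: "C1_on S u" and x: "x \<in> S"
  shows "(u has_derivative (\<lambda>h. gradient u x \<bullet> h)) (at x)"
proof -
  define c :: "real \<Rightarrow> real \<Rightarrow> real^2" where "c p q = vector [p, q]" for p q
  have c_comp [simp]: "c p q $ 1 = p" "c p q $ 2 = q" for p q by (simp_all add: c_def)
  have c_eta: "c (y $ 1) (y $ 2) = y" for y by (simp add: vec_eq_iff forall_2)
  have cont_c: "isCont (\<lambda>z. c (fst z) (snd z)) z" for z
    unfolding isCont_def
  proof (rule vec_tendstoI)
    show "((\<lambda>z. c (fst z) (snd z) $ i) \<longlongrightarrow> c (fst z) (snd z) $ i) (at z)" for i
      using exhaust_2[of i] tendsto_fst[OF tendsto_ident_at[of z UNIV]]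
        tendsto_snd[OF tendsto_ident_at[of z UNIV]] by auto
  qed
  obtain d where d: "d > 0" "ball x d \<subseteq> S"
    using S x open_contains_ball by blast
  define X where "X = ball (x $ 1) (d / 2)"
  define Y where "Y = ball (x $ 2) (d / 2)"
  have box: "c p q \<in> S" if "p \<in> X" "q \<in> Y" for p q
  proof -
    have "norm (x - c p q) \<le> \<bar>x $ 1 - p\<bar> + \<bar>x $ 2 - q\<bar>"
      using norm_le_l1_cart[of "x - c p q"] by (simp add: sum_2)
    also have "\<dots> < d" using that by (auto simp: X_def Y_def dist_real_def)
    finally show ?thesis using d by (auto simp: dist_norm)
  qed
  have partial: "((\<lambda>t. u (y + t *\<^sub>R axis i 1)) has_real_derivative partial_deriv i u y) (at 0)"
    if "y \<in> S" for y i
    using u that unfolding C1_on_def partial_deriv_def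
    by (simp add: DERIV_deriv_iff_field_differentiable)
  have p1: "((\<lambda>p. u (c p (y $ 2))) has_real_derivative partial_deriv 1 u y) (at (y $ 1))"
    if "y \<in> S" for y
  proof -
    have eq: "(\<lambda>h. u (y + h *\<^sub>R axis 1 1)) = (\<lambda>h. u (c (y $ 1 + h) (y $ 2)))"
      by (intro ext arg_cong[where f = u]) (simp add: vec_eq_iff forall_2 axis_def)
    show ?thesis
      using partial[OF that, of 1] DERIV_shift[of "\<lambda>p. u (c p (y $ 2))" _ 0 "y $ 1"]
      by (simp add: eq add.commute)
  qed
  have p2: "((\<lambda>q. u (c (y $ 1) q)) has_real_derivative partial_deriv 2 u y) (at (y $ 2))"
    if "y \<in> S" for y
  proof -
    have eq: "(\<lambda>h. u (y + h *\<^sub>R axis 2 1)) = (\<lambda>h. u (c (y $ 1) (y $ 2 + h)))"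
      by (intro ext arg_cong[where f = u]) (simp add: vec_eq_iff forall_2 axis_def)
    show ?thesis
      using partial[OF that, of 2] DERIV_shift[of "\<lambda>q. u (c (y $ 1) q)" _ 0 "y $ 2"]
      by (simp add: eq add.commute)
  qed
  have "isCont (partial_deriv 2 u) x"
    using u S x unfolding C1_on_def by (simp add: continuous_on_eq_continuous_at)
  then have cont2: "isCont (\<lambda>z. partial_deriv 2 u (c (fst z) (snd z))) (x $ 1, x $ 2)"
    using isCont_o2[OF cont_c[of "(x $ 1, x $ 2)"]] by (simp add: c_eta)
  have xXY: "x $ 1 \<in> X" "x $ 2 \<in> Y" using d by (auto simp: X_def Y_def)
  have "((\<lambda>(p, q). u (c p q)) has_derivative
      (\<lambda>(h, k). partial_deriv 1 u x * h + blinfun_mult_right (partial_deriv 2 u (c (x $ 1) (x $ 2))) k))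
      (at (x $ 1, x $ 2) within X \<times> Y)"
  proof (rule has_derivative_partialsI)
    show "((\<lambda>p. u (c p (x $ 2))) has_derivative ((*) (partial_deriv 1 u x))) (at (x $ 1) within X)"
      using p1[OF x] by (auto simp: has_field_derivative_def intro: has_derivative_at_withinI)
    show "((\<lambda>q. u (c p q)) has_derivative blinfun_mult_right (partial_deriv 2 u (c p q))) (at q within Y)"
      if "p \<in> X" "q \<in> Y" for p q
      using p2[OF box[OF that]] by (auto simp: has_field_derivative_def intro: has_derivative_at_withinI)
    show "continuous (at (x $ 1, x $ 2) within X \<times> Y) (\<lambda>(p, q). blinfun_mult_right (partial_deriv 2 u (c p q)))"
      unfolding case_prod_beta
      by (rule bounded_linear.continuous[OF bounded_linear_blinfun_mult_right
          continuous_at_imp_continuous_at_within[OF cont2]])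
    show "x $ 2 \<in> Y" "convex Y" using xXY by (simp_all add: Y_def)
  qed
  then have D: "((\<lambda>(p, q). u (c p q)) has_derivative
      (\<lambda>(h, k). partial_deriv 1 u x * h + partial_deriv 2 u x * k)) (at (x $ 1, x $ 2))"
    using xXY by (subst (asm) at_within_open) (auto simp: X_def Y_def open_Times c_eta)
  have "((\<lambda>y::real^2. (y $ 1, y $ 2)) has_derivative (\<lambda>h. (h $ 1, h $ 2))) (at x)"
    by (intro derivative_intros bounded_linear_imp_has_derivative bounded_linear_vec_nth)
  from has_derivative_compose[OF this D] show ?thesis
    by (simp add: c_eta gradient_def inner_vec_def sum_2)
qed

text \<open>The derivative along the line is a fixed combination of the first partial derivatives, to
  which the previous lemma applies once more.\<close>
lemma jet2_line:
  fixes u :: "real^2 \<Rightarrow> real"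
  assumes S: "open S" and u: "C2_on S u" and x: "x \<in> S"
  shows "jet2 (\<lambda>t. u (x + t *\<^sub>R v)) (gradient u x \<bullet> v)
    (\<Sum>i\<in>UNIV. \<Sum>j\<in>UNIV. v $ i * v $ j * partial_deriv i (partial_deriv j u) x)"
proof -
  have C1: "C1_on S u" "C1_on S (partial_deriv j u)" for j
    using u by (auto simp: C2_on_def)
  have line: "((\<lambda>t. w (x + t *\<^sub>R v)) has_real_derivative gradient w (x + t *\<^sub>R v) \<bullet> v) (at t)"
    if "C1_on S w" "x + t *\<^sub>R v \<in> S" for w t
  proof -
    have "((\<lambda>t. x + t *\<^sub>R v) has_derivative (\<lambda>h. h *\<^sub>R v)) (at t)"
      by (auto intro!: derivative_eq_intros)
    from has_derivative_compose[OF this C1_on_has_derivative[OF S that]]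
    show ?thesis by (rule has_derivative_imp_has_field_derivative) simp
  qed
  have "((\<lambda>t. x + t *\<^sub>R v) \<longlongrightarrow> x + 0 *\<^sub>R v) (nhds 0)"
    by (intro tendsto_intros) (auto simp: filterlim_ident)
  then have near: "\<forall>\<^sub>F t in nhds 0. x + t *\<^sub>R v \<in> S"
    using topological_tendstoD[OF _ S] x by fastforce
  show ?thesis
  proof (rule jet2I[where D = "\<lambda>t. gradient u (x + t *\<^sub>R v) \<bullet> v"])
    show "\<forall>\<^sub>F t in nhds 0. ((\<lambda>t. u (x + t *\<^sub>R v)) has_real_derivative gradient u (x + t *\<^sub>R v) \<bullet> v) (at t)"
      using near by eventually_elim (rule line[OF C1(1)])
    have "((\<lambda>t. v $ 1 * partial_deriv 1 u (x + t *\<^sub>R v) + v $ 2 * partial_deriv 2 u (x + t *\<^sub>R v))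
      has_real_derivative v $ 1 * (gradient (partial_deriv 1 u) x \<bullet> v) + v $ 2 * (gradient (partial_deriv 2 u) x \<bullet> v)) (at 0)"
      using line[OF C1(2), of 0] x by (auto intro!: derivative_eq_intros)
    then show "((\<lambda>t. gradient u (x + t *\<^sub>R v) \<bullet> v) has_real_derivative
      (\<Sum>i\<in>UNIV. \<Sum>j\<in>UNIV. v $ i * v $ j * partial_deriv i (partial_deriv j u) x)) (at 0)"
      by (simp add: gradient_def inner_vec_def sum_2 algebra_simps)
  qed simp
qed

section \<open>Straight lines in polar coordinates\<close>

text \<open>The vector with radial component \<open>a\<close> and angular component \<open>b\<close> with respect to the
  orthonormal polar frame at angle \<open>\<tau>\<close>.\<close>
definition frame :: "real \<Rightarrow> real \<Rightarrow> real \<Rightarrow> real^2" where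
  "frame \<tau> a b = vector [a * cos \<tau> - b * sin \<tau>, a * sin \<tau> + b * cos \<tau>]"

lemma frame_nth [simp]:
  "frame \<tau> a b $ 1 = a * cos \<tau> - b * sin \<tau>" "frame \<tau> a b $ 2 = a * sin \<tau> + b * cos \<tau>"
  by (simp_all add: frame_def)

lemma polar_eq_frame: "polar r \<tau> = frame \<tau> r 0"
  by (simp add: polar_def frame_def)

lemma polar_add_frame: "polar \<rho> \<tau> + t *\<^sub>R frame \<tau> a b = frame \<tau> (\<rho> + t * a) (t * b)"
  by (simp add: polar_eq_frame vec_eq_iff forall_2 algebra_simps)

lemma frame_eq_polar:
  assumes "X > 0"
  shows "frame \<tau> X Y = polar (sqrt (X\<^sup>2 + Y\<^sup>2)) (\<tau> + arctan (Y / X))"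
proof -
  define s where "s = sqrt (X\<^sup>2 + Y\<^sup>2)"
  define w where "w = sqrt (1 + (Y / X)\<^sup>2)"
  have w: "w > 0" by (simp add: w_def add_pos_nonneg)
  have "X * w = sqrt (X\<^sup>2 * (1 + (Y / X)\<^sup>2))"
    using assms by (simp add: w_def real_sqrt_mult)
  also have "X\<^sup>2 * (1 + (Y / X)\<^sup>2) = X\<^sup>2 + Y\<^sup>2"
    using assms by (simp add: field_simps)
  finally have s: "s = X * w" by (simp add: s_def)
  have "s * cos (arctan (Y / X)) = X" "s * sin (arctan (Y / X)) = Y"
    using w assms by (simp_all add: cos_arctan sin_arctan s flip: w_def)
  then have "frame \<tau> X Y = frame \<tau> (s * cos (arctan (Y / X))) (s * sin (arctan (Y / X)))"
    by simp
  also have "\<dots> = polar s (\<tau> + arctan (Y / X))"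
    by (simp add: polar_eq_frame vec_eq_iff forall_2 cos_add sin_add algebra_simps)
  finally show ?thesis by (simp add: s_def)
qed

lemma frame_components:
  "x = frame \<tau> (x \<bullet> frame \<tau> 1 0) (x \<bullet> frame \<tau> 0 1)"
proof -
  have "x $ 1 = x $ 1 * ((cos \<tau>)\<^sup>2 + (sin \<tau>)\<^sup>2)" "x $ 2 = x $ 2 * ((cos \<tau>)\<^sup>2 + (sin \<tau>)\<^sup>2)"
    by simp_all
  then show ?thesis
    unfolding vec_eq_iff forall_2
    by (simp add: inner_vec_def sum_2 algebra_simps power2_eq_square del: sin_cos_squared_add3)
qed

text \<open>Radius and angle of the point reached at time \<open>t\<close> from the point with polar coordinates
  \<open>(\<rho>, \<tau>)\<close> with the velocity \<open>frame \<tau> a b\<close>. The angle is the branch that starts at \<open>\<tau>\<close>;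
  it is correct as long as the point stays in the half-plane \<open>\<rho> + t a > 0\<close>.\<close>
definition line_radius :: "real \<Rightarrow> real \<Rightarrow> real \<Rightarrow> real \<Rightarrow> real" where
  "line_radius \<rho> a b t = sqrt ((\<rho> + t * a)\<^sup>2 + (t * b)\<^sup>2)"

definition line_angle :: "real \<Rightarrow> real \<Rightarrow> real \<Rightarrow> real \<Rightarrow> real \<Rightarrow> real" where
  "line_angle \<rho> \<tau> a b t = \<tau> + arctan (t * b / (\<rho> + t * a))"

lemma line_at_0 [simp]:
  "\<rho> > 0 \<Longrightarrow> line_radius \<rho> a b 0 = \<rho>" "line_angle \<rho> \<tau> a b 0 = \<tau>"
  by (simp_all add: line_radius_def line_angle_def)

lemma eventually_line_pos:
  assumes "\<rho> > 0"
  shows "\<forall>\<^sub>F t in nhds (0::real). 0 < \<rho> + t * a"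
proof -
  have "((\<lambda>t. \<rho> + t * a) \<longlongrightarrow> \<rho> + 0 * a) (nhds 0)"
    by (intro tendsto_intros) (simp add: filterlim_ident)
  with assms show ?thesis using order_tendstoD(1)[of _ "\<rho>" "nhds 0" 0] by simp
qed

lemma eventually_line_polar:
  assumes "\<rho> > 0"
  shows "\<forall>\<^sub>F t in nhds 0. polar \<rho> \<tau> + t *\<^sub>R frame \<tau> a b =
    polar (line_radius \<rho> a b t) (line_angle \<rho> \<tau> a b t)"
  using eventually_line_pos[OF assms, of a]
  by eventually_elim
    (simp only: polar_add_frame frame_eq_polar line_radius_def line_angle_def)

lemma jet2_line_radius:
  assumes "\<rho> > 0"
  shows "jet2 (line_radius \<rho> a b) a (b\<^sup>2 / \<rho>)"
proof (rule jet2I[where D = "\<lambda>t. ((\<rho> + t * a) * a + t * b * b) / line_radius \<rho> a b t"])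
  have der: "(line_radius \<rho> a b has_real_derivative ((\<rho> + t * a) * a + t * b * b) / line_radius \<rho> a b t) (at t)"
    if "0 < \<rho> + t * a" for t
  proof -
    have "0 < (\<rho> + t * a)\<^sup>2 + (t * b)\<^sup>2" using that by (simp add: add_pos_nonneg)
    then show ?thesis unfolding line_radius_def
      by (auto intro!: derivative_eq_intros simp: field_simps power2_eq_square)
  qed
  show "\<forall>\<^sub>F t in nhds 0. (line_radius \<rho> a b has_real_derivative ((\<rho> + t * a) * a + t * b * b) / line_radius \<rho> a b t) (at t)"
    using eventually_line_pos[OF assms, of a] by eventually_elim (rule der)
  show "((\<lambda>t. ((\<rho> + t * a) * a + t * b * b) / line_radius \<rho> a b t) has_real_derivative b\<^sup>2 / \<rho>) (at 0)"
    using assms der[of 0]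
    by (auto intro!: derivative_eq_intros simp: field_simps power2_eq_square)
qed (use assms in simp)

lemma jet2_line_angle:
  assumes "\<rho> > 0"
  shows "jet2 (line_angle \<rho> \<tau> a b) (b / \<rho>) (- 2 * a * b / \<rho>\<^sup>2)"
proof (rule jet2I[where D = "\<lambda>t. \<rho> * b / ((\<rho> + t * a)\<^sup>2 + (t * b)\<^sup>2)"])
  have der: "(line_angle \<rho> \<tau> a b has_real_derivative \<rho> * b / ((\<rho> + t * a)\<^sup>2 + (t * b)\<^sup>2)) (at t)"
    if pos: "0 < \<rho> + t * a" for t
  proof -
    have "((\<lambda>t. t * b / (\<rho> + t * a)) has_real_derivative \<rho> * b / (\<rho> + t * a)\<^sup>2) (at t)"
      using pos by (auto intro!: derivative_eq_intros simp: field_simps power2_eq_square)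
    then have "(line_angle \<rho> \<tau> a b has_real_derivative
      0 + inverse (1 + (t * b / (\<rho> + t * a))\<^sup>2) * (\<rho> * b / (\<rho> + t * a)\<^sup>2)) (at t)"
      unfolding line_angle_def by (intro DERIV_add DERIV_const DERIV_chain2[OF DERIV_arctan])
    moreover have "1 + (t * b / (\<rho> + t * a))\<^sup>2 = ((\<rho> + t * a)\<^sup>2 + (t * b)\<^sup>2) / (\<rho> + t * a)\<^sup>2"
      using pos by (simp add: field_simps)
    ultimately show ?thesis using pos by simp
  qed
  show "\<forall>\<^sub>F t in nhds 0. (line_angle \<rho> \<tau> a b has_real_derivative \<rho> * b / ((\<rho> + t * a)\<^sup>2 + (t * b)\<^sup>2)) (at t)"
    using eventually_line_pos[OF assms, of a] by eventually_elim (rule der)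
  show "((\<lambda>t. \<rho> * b / ((\<rho> + t * a)\<^sup>2 + (t * b)\<^sup>2)) has_real_derivative - 2 * a * b / \<rho>\<^sup>2) (at 0)"
    using assms
    by (auto intro!: derivative_eq_intros simp: field_simps power2_eq_square)
qed (use assms in \<open>simp add: power2_eq_square\<close>)

section \<open>The operator on functions of radius and angle\<close>

text \<open>This says that, at the point with polar coordinates \<open>(\<rho>, \<tau>)\<close>, the elliptic operator with
  coefficients \<open>B\<close> and \<open>\<beta>\<close>, applied to the function \<open>W\<close> of radius and angle, is at least \<open>c\<close>.
  The numbers \<open>P1, P2\<close> and \<open>Q11, Q12, Q22\<close> are the gradient and the Hessian of \<open>W\<close> in the polar
  frame, characterised by the jets of \<open>W\<close> along all lines through the point. The existential form
  makes the notion stable under sums and nonnegative multiples.\<close>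
definition polar_op_ge ::
  "real^2^2 \<Rightarrow> real^2 \<Rightarrow> (real \<Rightarrow> real \<Rightarrow> real) \<Rightarrow> real \<Rightarrow> real \<Rightarrow> real \<Rightarrow> bool" where
  "polar_op_ge B \<beta> W \<rho> \<tau> c \<longleftrightarrow> (\<exists>P1 P2 Q11 Q12 Q22.
     (\<forall>a b. jet2 (\<lambda>t. W (line_radius \<rho> a b t) (line_angle \<rho> \<tau> a b t))
        (P1 * a + P2 * b) (Q11 * a\<^sup>2 + 2 * Q12 * a * b + Q22 * b\<^sup>2)) \<and>
     c \<le> - ((frame \<tau> 1 0 \<bullet> (B *v frame \<tau> 1 0)) * Q11 + 2 * (frame \<tau> 1 0 \<bullet> (B *v frame \<tau> 0 1)) * Q12
           + (frame \<tau> 0 1 \<bullet> (B *v frame \<tau> 0 1)) * Q22)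
         + (\<beta> \<bullet> frame \<tau> 1 0) * P1 + (\<beta> \<bullet> frame \<tau> 0 1) * P2)"

lemma polar_op_geI:
  assumes "\<And>a b. jet2 (\<lambda>t. W (line_radius \<rho> a b t) (line_angle \<rho> \<tau> a b t))
        (P1 * a + P2 * b) (Q11 * a\<^sup>2 + 2 * Q12 * a * b + Q22 * b\<^sup>2)"
    and "c \<le> - ((frame \<tau> 1 0 \<bullet> (B *v frame \<tau> 1 0)) * Q11 + 2 * (frame \<tau> 1 0 \<bullet> (B *v frame \<tau> 0 1)) * Q12
           + (frame \<tau> 0 1 \<bullet> (B *v frame \<tau> 0 1)) * Q22)
         + (\<beta> \<bullet> frame \<tau> 1 0) * P1 + (\<beta> \<bullet> frame \<tau> 0 1) * P2"
  shows "polar_op_ge B \<beta> W \<rho> \<tau> c"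
  using assms unfolding polar_op_ge_def by blast

lemma polar_op_ge_const: "polar_op_ge B \<beta> (\<lambda>_ _. k) \<rho> \<tau> 0"
  unfolding polar_op_ge_def
  by (rule exI[of _ 0])+ (simp add: jet2_const)

lemma polar_op_ge_add:
  assumes "polar_op_ge B \<beta> V \<rho> \<tau> c" "polar_op_ge B \<beta> W \<rho> \<tau> d"
  shows "polar_op_ge B \<beta> (\<lambda>r \<theta>. V r \<theta> + W r \<theta>) \<rho> \<tau> (c + d)"
proof -
  from assms(1) obtain P1 P2 Q11 Q12 Q22 where
     P: "jet2 (\<lambda>t. V (line_radius \<rho> a b t) (line_angle \<rho> \<tau> a b t))
        (P1 * a + P2 * b) (Q11 * a\<^sup>2 + 2 * Q12 * a * b + Q22 * b\<^sup>2)"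
     "c \<le> - ((frame \<tau> 1 0 \<bullet> (B *v frame \<tau> 1 0)) * Q11 + 2 * (frame \<tau> 1 0 \<bullet> (B *v frame \<tau> 0 1)) * Q12
           + (frame \<tau> 0 1 \<bullet> (B *v frame \<tau> 0 1)) * Q22)
         + (\<beta> \<bullet> frame \<tau> 1 0) * P1 + (\<beta> \<bullet> frame \<tau> 0 1) * P2" for a b
    unfolding polar_op_ge_def by blast
  from assms(2) obtain P1' P2' Q11' Q12' Q22' where
     P': "jet2 (\<lambda>t. W (line_radius \<rho> a b t) (line_angle \<rho> \<tau> a b t))
        (P1' * a + P2' * b) (Q11' * a\<^sup>2 + 2 * Q12' * a * b + Q22' * b\<^sup>2)"
     "d \<le> - ((frame \<tau> 1 0 \<bullet> (B *v frame \<tau> 1 0)) * Q11' + 2 * (frame \<tau> 1 0 \<bullet> (B *v frame \<tau> 0 1)) * Q12'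
           + (frame \<tau> 0 1 \<bullet> (B *v frame \<tau> 0 1)) * Q22')
         + (\<beta> \<bullet> frame \<tau> 1 0) * P1' + (\<beta> \<bullet> frame \<tau> 0 1) * P2'" for a b
    unfolding polar_op_ge_def by blast
  show ?thesis unfolding polar_op_ge_def
  proof (intro exI conjI allI)
    fix a b
    show "jet2 (\<lambda>t. V (line_radius \<rho> a b t) (line_angle \<rho> \<tau> a b t) + W (line_radius \<rho> a b t) (line_angle \<rho> \<tau> a b t))
       ((P1 + P1') * a + (P2 + P2') * b)
       ((Q11 + Q11') * a\<^sup>2 + 2 * (Q12 + Q12') * a * b + (Q22 + Q22') * b\<^sup>2)"
      using jet2_add[OF P(1) P'(1), of a b a b] by (simp add: algebra_simps)
  qed (use add_mono[OF P(2) P'(2)] in \<open>simp add: algebra_simps\<close>)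
qed

lemma polar_op_ge_scale:
  assumes "polar_op_ge B \<beta> W \<rho> \<tau> c" "k \<ge> 0"
  shows "polar_op_ge B \<beta> (\<lambda>r \<theta>. k * W r \<theta>) \<rho> \<tau> (k * c)"
proof -
  from assms(1) obtain P1 P2 Q11 Q12 Q22 where
     P: "jet2 (\<lambda>t. W (line_radius \<rho> a b t) (line_angle \<rho> \<tau> a b t))
        (P1 * a + P2 * b) (Q11 * a\<^sup>2 + 2 * Q12 * a * b + Q22 * b\<^sup>2)"
     "c \<le> - ((frame \<tau> 1 0 \<bullet> (B *v frame \<tau> 1 0)) * Q11 + 2 * (frame \<tau> 1 0 \<bullet> (B *v frame \<tau> 0 1)) * Q12
           + (frame \<tau> 0 1 \<bullet> (B *v frame \<tau> 0 1)) * Q22)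
         + (\<beta> \<bullet> frame \<tau> 1 0) * P1 + (\<beta> \<bullet> frame \<tau> 0 1) * P2" for a b
    unfolding polar_op_ge_def by blast
  show ?thesis unfolding polar_op_ge_def
  proof (intro exI conjI allI)
    fix a b
    show "jet2 (\<lambda>t. k * W (line_radius \<rho> a b t) (line_angle \<rho> \<tau> a b t))
       ((k * P1) * a + (k * P2) * b)
       ((k * Q11) * a\<^sup>2 + 2 * (k * Q12) * a * b + (k * Q22) * b\<^sup>2)"
      using jet2_cmult[OF P(1), of k a b] by (simp add: algebra_simps)
  qed (use mult_left_mono[OF P(2) assms(2)] in \<open>simp add: algebra_simps\<close>)
qed

section \<open>The barrier\<close>

definition barrier :: "real \<Rightarrow> real \<Rightarrow> real \<Rightarrow> real \<Rightarrow> real \<Rightarrow> real" where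
  "barrier \<alpha> R \<mu> r \<theta> = exp (\<mu> * \<theta>) * (2 - exp (\<alpha> * (r - R)))"

lemma barrier_bounds:
  assumes "\<alpha> \<ge> 0" "r \<le> R"
  shows "exp (\<mu> * \<theta>) \<le> barrier \<alpha> R \<mu> r \<theta>" "barrier \<alpha> R \<mu> r \<theta> \<le> 2 * exp (\<mu> * \<theta>)"
proof -
  have "exp (\<alpha> * (r - R)) \<le> 1"
    using assms by (simp add: mult_nonneg_nonpos)
  then show "exp (\<mu> * \<theta>) \<le> barrier \<alpha> R \<mu> r \<theta>" "barrier \<alpha> R \<mu> r \<theta> \<le> 2 * exp (\<mu> * \<theta>)"
    by (simp_all add: barrier_def)
qed

text \<open>The coefficients are the gradient \<open>(W\<^sub>r, W\<^sub>\<theta>/\<rho>)\<close> and the Hessian with entries \<open>W\<^sub>r\<^sub>r\<close>,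
  \<open>W\<^sub>r\<^sub>\<theta>/\<rho> - W\<^sub>\<theta>/\<rho>\<^sup>2\<close> and \<open>W\<^sub>\<theta>\<^sub>\<theta>/\<rho>\<^sup>2 + W\<^sub>r/\<rho>\<close> of the barrier in the polar frame, written out.\<close>
lemma jet2_barrier:
  fixes \<alpha> R \<mu> \<tau> :: real
  assumes \<rho>: "\<rho> > 0"
  defines "E \<equiv> exp (\<alpha> * (\<rho> - R))" and "g \<equiv> exp (\<mu> * \<tau>)"
  shows "jet2 (\<lambda>t. barrier \<alpha> R \<mu> (line_radius \<rho> a b t) (line_angle \<rho> \<tau> a b t))
    ((- g * \<alpha> * E) * a + (g * \<mu> * (2 - E) / \<rho>) * b)
    ((- g * \<alpha>\<^sup>2 * E) * a\<^sup>2 + 2 * (- g * \<mu> * (\<alpha> * E / \<rho> + (2 - E) / \<rho>\<^sup>2)) * a * b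
      + (g * (\<mu>\<^sup>2 * (2 - E) / \<rho>\<^sup>2 - \<alpha> * E / \<rho>)) * b\<^sup>2)"
proof -
  note r = jet2_line_radius[OF \<rho>, of a b] and \<theta> = jet2_line_angle[OF \<rho>, of \<tau> a b]
  note angular = jet2_exp[OF jet2_cmult[OF \<theta>, of \<mu>]]
  note radial = jet2_diff[OF jet2_const[of 2]
      jet2_exp[OF jet2_cmult[OF jet2_diff[OF r jet2_const[of R]], of \<alpha>]]]
  have "jet2 (\<lambda>t. barrier \<alpha> R \<mu> (line_radius \<rho> a b t) (line_angle \<rho> \<tau> a b t))
    (g * (\<mu> * (b / \<rho>)) * (2 - E) + g * (0 - E * (\<alpha> * (a - 0))))
    (g * (\<mu> * (- 2 * a * b / \<rho>\<^sup>2) + (\<mu> * (b / \<rho>))\<^sup>2) * (2 - E)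
      + 2 * (g * (\<mu> * (b / \<rho>))) * (0 - E * (\<alpha> * (a - 0)))
      + g * (0 - E * (\<alpha> * (b\<^sup>2 / \<rho> - 0) + (\<alpha> * (a - 0))\<^sup>2)))"
    using jet2_mult[OF angular radial]
    unfolding line_at_0(1)[OF \<rho>] line_at_0(2) barrier_def E_def g_def .
  moreover have "g * (\<mu> * (b / \<rho>)) * (2 - E) + g * (0 - E * (\<alpha> * (a - 0)))
      = (- g * \<alpha> * E) * a + (g * \<mu> * (2 - E) / \<rho>) * b"
    by (simp add: algebra_simps add_divide_distrib diff_divide_distrib)
  moreover have "g * (\<mu> * (- 2 * a * b / \<rho>\<^sup>2) + (\<mu> * (b / \<rho>))\<^sup>2) * (2 - E)
      + 2 * (g * (\<mu> * (b / \<rho>))) * (0 - E * (\<alpha> * (a - 0)))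
      + g * (0 - E * (\<alpha> * (b\<^sup>2 / \<rho> - 0) + (\<alpha> * (a - 0))\<^sup>2))
    = (- g * \<alpha>\<^sup>2 * E) * a\<^sup>2 + 2 * (- g * \<mu> * (\<alpha> * E / \<rho> + (2 - E) / \<rho>\<^sup>2)) * a * b
      + (g * (\<mu>\<^sup>2 * (2 - E) / \<rho>\<^sup>2 - \<alpha> * E / \<rho>)) * b\<^sup>2"
    using \<rho> by (simp add: field_simps power2_eq_square)
  ultimately show ?thesis by (simp only:)
qed

text \<open>The choice of \<open>\<alpha>\<close> makes the second radial derivative beat the drift with a margin that is at
  least \<open>\<alpha> e\<^bsup>\<alpha>(s - R)\<^esup>\<close>. All terms produced by the angular factor are bounded by \<open>\<bar>\<mu>\<bar> N\<close> for a
  constant \<open>N\<close> that depends on the bounds only, and \<open>\<nu>\<close> is chosen so that they use up at most half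
  of the margin. The same \<open>\<delta>\<close> and \<open>\<nu>\<close> serve all coefficients within the bounds.\<close>
lemma barrier_strict_supersolution:
  fixes c0 M1 M2 s R :: real
  assumes "c0 > 0" "M1 > 0" "M2 \<ge> 0" "s > 0"
  obtains \<alpha> \<delta> \<nu> where "\<alpha> \<ge> 0" "\<delta> > 0" "\<nu> > 0"
    "\<And>B \<beta> \<mu> \<rho> \<tau>. \<lbrakk>transpose B = B; \<And>\<xi>. c0 * (norm \<xi>)\<^sup>2 \<le> \<xi> \<bullet> (B *v \<xi>); trace B \<le> M1;
       norm \<beta> \<le> M2; s \<le> \<rho>; \<rho> \<le> R; \<bar>\<mu>\<bar> \<le> \<nu>\<rbrakk>
     \<Longrightarrow> polar_op_ge B \<beta> (barrier \<alpha> R \<mu>) \<rho> \<tau> (\<delta> * exp (\<mu> * \<tau>))"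
proof -
  define \<alpha> where "\<alpha> = (M2 + 1) / c0"
  define \<kappa> where "\<kappa> = exp (\<alpha> * (s - R))"
  define \<delta> where "\<delta> = \<alpha> * \<kappa> / 2"
  define N where "N = M1 * (\<alpha> / s + 2 / s\<^sup>2) + 2 * M1 / s\<^sup>2 + 2 * M2 / s"
  \<comment> \<open>The cap at 1 gives \<open>\<mu>\<^sup>2 \<le> \<bar>\<mu>\<bar>\<close>, so that the quadratic term is covered by \<open>N\<close> as well.\<close>
  define \<nu> where "\<nu> = min 1 (\<delta> / N)"
  have \<alpha>: "\<alpha> > 0" "\<alpha> * c0 - M2 = 1" using assms by (auto simp: \<alpha>_def)
  have \<delta>: "\<delta> > 0" using \<alpha> by (simp add: \<delta>_def \<kappa>_def)
  have "M1 * (\<alpha> / s + 2 / s\<^sup>2) > 0"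
    using assms \<alpha>(1) by (intro mult_pos_pos add_pos_pos) auto
  then have N: "N > 0"
    unfolding N_def using assms by (intro add_pos_nonneg) auto
  have \<nu>: "\<nu> > 0" using \<delta> N by (simp add: \<nu>_def)
  show ?thesis
  proof (rule that[of \<alpha> \<delta> \<nu>])
    fix B :: "real^2^2" and \<beta> :: "real^2" and \<mu> \<rho> \<tau> :: real
    assume sym: "transpose B = B" and ell: "\<And>\<xi>. c0 * (norm \<xi>)\<^sup>2 \<le> \<xi> \<bullet> (B *v \<xi>)"
      and tr: "trace B \<le> M1" and \<beta>: "norm \<beta> \<le> M2" and \<rho>: "s \<le> \<rho>" "\<rho> \<le> R" and \<mu>: "\<bar>\<mu>\<bar> \<le> \<nu>"
    define er where "er = frame \<tau> 1 0"
    define et where "et = frame \<tau> 0 1"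
    define p where "p = er \<bullet> (B *v er)"
    define q where "q = er \<bullet> (B *v et)"
    define k where "k = et \<bullet> (B *v et)"
    define E where "E = exp (\<alpha> * (\<rho> - R))"
    define g where "g = exp (\<mu> * \<tau>)"
    have nrm: "norm er = 1" "norm et = 1"
      by (simp_all add: er_def et_def norm_vec_def L2_set_def sum_2)
    have B21: "B $ 2 $ 1 = B $ 1 $ 2"
      using arg_cong[OF sym, of "\<lambda>M. M $ 1 $ 2"] by (simp add: transpose_def)
    have "p + k = trace B * ((cos \<tau>)\<^sup>2 + (sin \<tau>)\<^sup>2)"
      unfolding p_def k_def er_def et_def inner_vec_def matrix_vector_mult_def trace_def
      by (simp add: sum_2 B21 power2_eq_square algebra_simps
          del: sin_cos_squared_add sin_cos_squared_add2 sin_cos_squared_add3)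
    then have trB: "trace B = p + k" by simp
    have p: "c0 \<le> p" using ell[of er] by (simp add: nrm p_def)
    have k: "0 \<le> k" using ell[of et] assms(1) by (simp add: nrm k_def)
    have kM: "k \<le> M1" using tr trB p assms(1) by linarith
    \<comment> \<open>Positivity of the form on the two diagonals of the frame bounds the mixed entry by the trace.\<close>
    have "0 \<le> p + k + 2 * q" "0 \<le> p + k - 2 * q"
    proof -
      have *: "0 \<le> (er + a *\<^sub>R et) \<bullet> (B *v (er + a *\<^sub>R et))" for a
        using ell[of "er + a *\<^sub>R et"] assms(1) by (meson order_trans mult_nonneg_nonneg less_imp_le zero_le_power2)
      have "et \<bullet> (B *v er) = q"
        unfolding q_def er_def et_def inner_vec_def matrix_vector_mult_def
        by (simp add: sum_2 B21 algebra_simps)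
      then show "0 \<le> p + k + 2 * q" "0 \<le> p + k - 2 * q"
        using *[of 1] *[of "-1"]
        by (simp_all add: p_def q_def k_def matrix_vector_right_distrib matrix_vector_mult_diff_distrib
            inner_add_left inner_add_right inner_diff_left inner_diff_right algebra_simps)
    qed
    then have q: "\<bar>2 * q\<bar> \<le> M1" using tr trB by linarith
    have br: "\<bar>\<beta> \<bullet> er\<bar> \<le> M2" "\<bar>\<beta> \<bullet> et\<bar> \<le> M2"
      using Cauchy_Schwarz_ineq2[of \<beta> er] Cauchy_Schwarz_ineq2[of \<beta> et] \<beta> by (auto simp: nrm)
    have E: "\<kappa> \<le> E" "E \<le> 1" "0 < E"
      using \<rho> \<alpha> by (auto simp: E_def \<kappa>_def mult_nonneg_nonpos)
    have \<rho>0: "\<rho> > 0" using \<rho> assms by simp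
    have inv: "1 / \<rho> \<le> 1 / s" "1 / \<rho>\<^sup>2 \<le> 1 / s\<^sup>2"
      using \<rho> assms by (auto intro!: divide_left_mono power_mono)
    have main: "\<alpha> * \<kappa> \<le> \<alpha>\<^sup>2 * E * p - \<alpha> * E * (\<beta> \<bullet> er)"
    proof -
      have "\<alpha> * c0 \<le> \<alpha> * p" using p \<alpha> by simp
      then have "1 \<le> \<alpha> * p - \<beta> \<bullet> er" using \<alpha>(2) br(1) by linarith
      then have "\<alpha> * E * 1 \<le> \<alpha> * E * (\<alpha> * p - \<beta> \<bullet> er)"
        using \<alpha> E by (intro mult_left_mono) auto
      moreover have "\<alpha> * \<kappa> \<le> \<alpha> * E" using \<alpha> E by simp
      ultimately show ?thesis by (simp add: algebra_simps power2_eq_square)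
    qed
    have e1: "\<bar>2 * q * \<mu> * (\<alpha> * E / \<rho> + (2 - E) / \<rho>\<^sup>2)\<bar> \<le> \<bar>\<mu>\<bar> * (M1 * (\<alpha> / s + 2 / s\<^sup>2))"
    proof -
      have "\<alpha> * E / \<rho> \<le> \<alpha> / s"
        using \<alpha> E inv(1) \<rho>0 mult_mono[of "\<alpha> * E" "\<alpha>" "1 / \<rho>" "1 / s"] by simp
      moreover have "(2 - E) / \<rho>\<^sup>2 \<le> 2 / s\<^sup>2"
        using E inv(2) mult_mono[of "2 - E" 2 "1 / \<rho>\<^sup>2" "1 / s\<^sup>2"] by simp
      ultimately have "\<bar>\<alpha> * E / \<rho> + (2 - E) / \<rho>\<^sup>2\<bar> \<le> \<alpha> / s + 2 / s\<^sup>2"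
        using \<alpha> E \<rho>0 by auto
      then have "\<bar>2 * q\<bar> * \<bar>\<alpha> * E / \<rho> + (2 - E) / \<rho>\<^sup>2\<bar> \<le> M1 * (\<alpha> / s + 2 / s\<^sup>2)"
        using q assms by (intro mult_mono) auto
      from mult_left_mono[OF this, of "\<bar>\<mu>\<bar>"] show ?thesis
        by (simp only: abs_mult mult_ac abs_ge_zero)
    qed
    have e2: "k * \<mu>\<^sup>2 * (2 - E) / \<rho>\<^sup>2 \<le> \<bar>\<mu>\<bar> * (2 * M1 / s\<^sup>2)"
    proof -
      have "\<mu>\<^sup>2 = \<bar>\<mu>\<bar> * \<bar>\<mu>\<bar>" by (simp add: power2_eq_square)
      also have "\<dots> \<le> \<bar>\<mu>\<bar> * 1" using \<mu> by (intro mult_left_mono) (auto simp: \<nu>_def)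
      finally have "\<mu>\<^sup>2 \<le> \<bar>\<mu>\<bar>" by simp
      then have "k * \<mu>\<^sup>2 \<le> M1 * \<bar>\<mu>\<bar>" using k kM by (intro mult_mono) auto
      then have "(k * \<mu>\<^sup>2) * (2 - E) \<le> (M1 * \<bar>\<mu>\<bar>) * 2"
        using E k assms by (intro mult_mono[of "k * \<mu>\<^sup>2" _ "2 - E"]) auto
      then have "((k * \<mu>\<^sup>2) * (2 - E)) * (1 / \<rho>\<^sup>2) \<le> ((M1 * \<bar>\<mu>\<bar>) * 2) * (1 / s\<^sup>2)"
        using inv(2) assms by (intro mult_mono[of "k * \<mu>\<^sup>2 * (2 - E)" _ "1 / \<rho>\<^sup>2"]) auto
      then show ?thesis by (simp add: mult_ac)
    qed
    have e3: "\<bar>\<mu> * (2 - E) / \<rho> * (\<beta> \<bullet> et)\<bar> \<le> \<bar>\<mu>\<bar> * (2 * M2 / s)"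
    proof -
      have "\<bar>2 - E\<bar> * \<bar>\<beta> \<bullet> et\<bar> \<le> 2 * M2" using E br by (intro mult_mono) auto
      then have "(\<bar>2 - E\<bar> * \<bar>\<beta> \<bullet> et\<bar>) * (1 / \<rho>) \<le> (2 * M2) * (1 / s)"
        using inv(1) \<rho>0 assms by (intro mult_mono[of "\<bar>2 - E\<bar> * \<bar>\<beta> \<bullet> et\<bar>" _ "1 / \<rho>"]) auto
      from mult_left_mono[OF this, of "\<bar>\<mu>\<bar>"] \<rho>0 show ?thesis by (simp add: abs_mult mult_ac)
    qed
    have e4: "0 \<le> k * (\<alpha> * E / \<rho>)" using k \<alpha> E \<rho>0 by simp
    have "\<bar>\<mu>\<bar> * N \<le> \<delta> / N * N" using \<mu> N by (intro mult_right_mono) (auto simp: \<nu>_def)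
    then have "\<delta> \<le> \<alpha> * \<kappa> - \<bar>\<mu>\<bar> * N" using N by (simp add: \<delta>_def)
    also have "\<dots> \<le> \<alpha>\<^sup>2 * E * p - \<alpha> * E * (\<beta> \<bullet> er) + 2 * q * \<mu> * (\<alpha> * E / \<rho> + (2 - E) / \<rho>\<^sup>2)
       - k * \<mu>\<^sup>2 * (2 - E) / \<rho>\<^sup>2 + k * (\<alpha> * E / \<rho>) + \<mu> * (2 - E) / \<rho> * (\<beta> \<bullet> et)"
    proof -
      have "\<bar>\<mu>\<bar> * N = \<bar>\<mu>\<bar> * (M1 * (\<alpha> / s + 2 / s\<^sup>2)) + \<bar>\<mu>\<bar> * (2 * M1 / s\<^sup>2) + \<bar>\<mu>\<bar> * (2 * M2 / s)"
        by (simp add: N_def distrib_left)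
      with main abs_le_D2[OF e1] e2 abs_le_D2[OF e3] e4 show ?thesis by linarith
    qed
    finally have "g * \<delta> \<le> g * (\<alpha>\<^sup>2 * E * p - \<alpha> * E * (\<beta> \<bullet> er) + 2 * q * \<mu> * (\<alpha> * E / \<rho> + (2 - E) / \<rho>\<^sup>2)
       - k * \<mu>\<^sup>2 * (2 - E) / \<rho>\<^sup>2 + k * (\<alpha> * E / \<rho>) + \<mu> * (2 - E) / \<rho> * (\<beta> \<bullet> et))"
      by (rule mult_left_mono) (simp add: g_def)
    then have "\<delta> * g \<le> - (p * (- g * \<alpha>\<^sup>2 * E) + 2 * q * (- g * \<mu> * (\<alpha> * E / \<rho> + (2 - E) / \<rho>\<^sup>2))
         + k * (g * (\<mu>\<^sup>2 * (2 - E) / \<rho>\<^sup>2 - \<alpha> * E / \<rho>)))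
       + (\<beta> \<bullet> er) * (- g * \<alpha> * E) + (\<beta> \<bullet> et) * (g * \<mu> * (2 - E) / \<rho>)"
      by (simp add: algebra_simps add_divide_distrib diff_divide_distrib)
    then show "polar_op_ge B \<beta> (barrier \<alpha> R \<mu>) \<rho> \<tau> (\<delta> * exp (\<mu> * \<tau>))"
      unfolding E_def g_def p_def q_def k_def er_def et_def
      by (rule polar_op_geI[OF jet2_barrier[OF \<rho>0]])
  qed (use \<alpha> \<delta> \<nu> in auto)
qed

lemma continuous_on_barrier: "continuous_on UNIV (\<lambda>z. barrier \<alpha> R \<mu> (fst z) (snd z))"
  unfolding barrier_def by (intro continuous_intros)

section \<open>The second derivative test against a function of radius and angle\<close>

text \<open>A symmetric matrix with entries \<open>x, y, z\<close> is recovered from its entries \<open>p, q, k\<close> in a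
  rotated orthonormal frame.\<close>
lemma frame_entries:
  fixes x y z c s :: real
  defines "p \<equiv> c * (x * c + y * s) + s * (y * c + z * s)"
    and "q \<equiv> c * (y * c - x * s) + s * (z * c - y * s)"
    and "k \<equiv> c * (z * c - y * s) - s * (y * c - x * s)"
  assumes "c\<^sup>2 + s\<^sup>2 = 1"
  shows "x = p * c\<^sup>2 - 2 * q * (c * s) + k * s\<^sup>2"
    "z = p * s\<^sup>2 + 2 * q * (c * s) + k * c\<^sup>2"
    "y = p * (c * s) + q * (c\<^sup>2 - s\<^sup>2) - k * (c * s)"
proof -
  have "p * c\<^sup>2 - 2 * q * (c * s) + k * s\<^sup>2 = x * (c\<^sup>2 + s\<^sup>2)\<^sup>2" 
  "p * s\<^sup>2 + 2 * q * (c * s) + k * c\<^sup>2 = z * (c\<^sup>2 + s\<^sup>2)\<^sup>2" 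
    "p * (c * s) + q * (c\<^sup>2 - s\<^sup>2) - k * (c * s) = y * (c\<^sup>2 + s\<^sup>2)\<^sup>2"
    unfolding p_def q_def k_def power2_eq_square by (simp_all add: algebra_simps)
  then show "x = p * c\<^sup>2 - 2 * q * (c * s) + k * s\<^sup>2"
    "z = p * s\<^sup>2 + 2 * q * (c * s) + k * c\<^sup>2"
    "y = p * (c * s) + q * (c\<^sup>2 - s\<^sup>2) - k * (c * s)" by (simp_all add: assms)
qed

text \<open>Completing the square in the form with rotated entries \<open>p\<close>, \<open>q = z p\<close>, \<open>k\<close> writes it as a
  combination, with weights \<open>p\<close> and \<open>k - z\<^sup>2 p\<close>, of the squares of two linear forms. The identity
  below is the resulting formula for the trace of the product with a matrix \<open>h\<close>, which thereby
  only involves the quadratic form of \<open>h\<close> in two directions.\<close>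
lemma rank_one_splitting:
  fixes p z k c s :: real
  shows "(p * c\<^sup>2 - 2 * (z * p) * (c * s) + k * s\<^sup>2) * h1 + (p * (c * s) + (z * p) * (c\<^sup>2 - s\<^sup>2) - k * (c * s)) * h2
   + ((p * (c * s) + (z * p) * (c\<^sup>2 - s\<^sup>2) - k * (c * s)) * h3 + (p * s\<^sup>2 + 2 * (z * p) * (c * s) + k * c\<^sup>2) * h4)
   = p * ((c - z * s) * (c - z * s) * h1 + (c - z * s) * (s + z * c) * h2 + ((s + z * c) * (c - z * s) * h3 + (s + z * c) * (s + z * c) * h4))
  + (k - z\<^sup>2 * p) * (s * s * h1 - s * c * h2 + (c * c * h4 - c * s * h3))"
  by (simp add: algebra_simps power2_eq_square)

text \<open>At a point where \<open>u1 - u2 - W\<close> has a local maximum, the gradients of \<open>u1 - u2\<close> and \<open>W\<close> agree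
  and the Hessian form of \<open>u1 - u2\<close> lies below that of \<open>W\<close> in every direction. Since the
  coefficient matrix is a positive combination of two rank one matrices, two directions suffice
  to compare the second order parts of the operator.\<close>
lemma touching_from_above:
  assumes S: "open S" "C2_on S u1" "C2_on S u2"
    and \<rho>: "\<rho> > 0" and x: "x = polar \<rho> \<tau>" "x \<in> S"
    and sym: "transpose (A x) = A x"
    and pos: "\<And>\<xi>. \<xi> \<noteq> 0 \<Longrightarrow> \<xi> \<bullet> (A x *v \<xi>) > 0"
    and W: "polar_op_ge (A x) (b x) W \<rho> \<tau> c"
    and max: "\<And>\<alpha> \<beta>. \<forall>\<^sub>F t in nhds 0. u1 (x + t *\<^sub>R frame \<tau> \<alpha> \<beta>) - u2 (x + t *\<^sub>R frame \<tau> \<alpha> \<beta>)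
        - W (line_radius \<rho> \<alpha> \<beta> t) (line_angle \<rho> \<tau> \<alpha> \<beta> t) \<le> u1 x - u2 x - W \<rho> \<tau>"
  shows "c \<le> elliptic_op A b u1 x - elliptic_op A b u2 x"
proof -
  define er where "er = frame \<tau> 1 0"
  define et where "et = frame \<tau> 0 1"
  define p where "p = er \<bullet> (A x *v er)"
  define q where "q = er \<bullet> (A x *v et)"
  define k where "k = et \<bullet> (A x *v et)"
  from W obtain P1 P2 Q11 Q12 Q22 where
     P: "jet2 (\<lambda>t. W (line_radius \<rho> \<alpha> \<beta> t) (line_angle \<rho> \<tau> \<alpha> \<beta> t))
        (P1 * \<alpha> + P2 * \<beta>) (Q11 * \<alpha>\<^sup>2 + 2 * Q12 * \<alpha> * \<beta> + Q22 * \<beta>\<^sup>2)"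
     and c: "c \<le> - (p * Q11 + 2 * q * Q12 + k * Q22) + (b x \<bullet> er) * P1 + (b x \<bullet> et) * P2" for \<alpha> \<beta>
    unfolding polar_op_ge_def p_def q_def k_def er_def et_def by blast
  define g where "g = gradient u1 x - gradient u2 x"
  define H where "H i j = partial_deriv i (partial_deriv j u1) x - partial_deriv i (partial_deriv j u2) x" for i j
  define HH where "HH v = (\<Sum>i\<in>UNIV. \<Sum>j\<in>UNIV. v $ i * v $ j * H i j)" for v :: "real^2"
  have test: "g \<bullet> frame \<tau> \<alpha> \<beta> = P1 * \<alpha> + P2 * \<beta> \<and>
    HH (frame \<tau> \<alpha> \<beta>) \<le> Q11 * \<alpha>\<^sup>2 + 2 * Q12 * \<alpha> * \<beta> + Q22 * \<beta>\<^sup>2" for \<alpha> \<beta>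
  proof -
    have "jet2 (\<lambda>t. u1 (x + t *\<^sub>R frame \<tau> \<alpha> \<beta>) - u2 (x + t *\<^sub>R frame \<tau> \<alpha> \<beta>)
        - W (line_radius \<rho> \<alpha> \<beta> t) (line_angle \<rho> \<tau> \<alpha> \<beta> t))
      (g \<bullet> frame \<tau> \<alpha> \<beta> - (P1 * \<alpha> + P2 * \<beta>))
      (HH (frame \<tau> \<alpha> \<beta>) - (Q11 * \<alpha>\<^sup>2 + 2 * Q12 * \<alpha> * \<beta> + Q22 * \<beta>\<^sup>2))"
      using jet2_diff[OF jet2_diff[OF jet2_line[OF S(1,2) x(2)] jet2_line[OF S(1,3) x(2)]] P[of \<alpha> \<beta>], of "frame \<tau> \<alpha> \<beta>" "frame \<tau> \<alpha> \<beta>"]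
      by (simp add: g_def HH_def H_def inner_diff_left right_diff_distrib sum_subtractf)
    from jet2_local_max[OF this] max[of \<alpha> \<beta>] \<rho> show ?thesis by auto
  qed
  have cs: "(cos \<tau>)\<^sup>2 + (sin \<tau>)\<^sup>2 = 1" by simp
  have A21: "A x $ 2 $ 1 = A x $ 1 $ 2"
    using arg_cong[OF sym, of "\<lambda>M. M $ 1 $ 2"] by (simp add: transpose_def)
  have nz: "frame \<tau> a b \<noteq> 0" if "a \<noteq> 0 \<or> b \<noteq> 0" for a b
  proof
    assume "frame \<tau> a b = 0"
    then have "a * cos \<tau> - b * sin \<tau> = 0" "a * sin \<tau> + b * cos \<tau> = 0"
      by (simp_all flip: frame_nth)
    with cs have "a = 0" "b = 0" by algebra+
    with that show False by simp
  qed
  have form: "frame \<tau> a b \<bullet> (A x *v frame \<tau> a b) = p * a\<^sup>2 + 2 * q * a * b + k * b\<^sup>2" for a b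
    unfolding p_def q_def k_def er_def et_def inner_vec_def matrix_vector_mult_def
    by (simp add: sum_2 A21 power2_eq_square algebra_simps)
  have p: "p > 0" unfolding p_def er_def by (rule pos) (simp add: nz)
  \<comment> \<open>The vector with components \<open>- q / p\<close> and \<open>1\<close> minimises the form among those with second
    component 1; its value is the weight of the second rank one piece.\<close>
  have "0 < p * (- q / p)\<^sup>2 + 2 * q * (- q / p) * 1 + k * 1\<^sup>2"
    unfolding form[symmetric] by (rule pos) (simp add: nz)
  also have "\<dots> = k - q\<^sup>2 / p" using p by (simp add: field_simps power2_eq_square)
  finally have k: "k - q\<^sup>2 / p > 0" .
  define z where "z = q / p"
  have z: "q = z * p" "q\<^sup>2 / p = z\<^sup>2 * p" using p by (auto simp: z_def power2_eq_square)
  have pqk: "p = cos \<tau> * (A x $ 1 $ 1 * cos \<tau> + A x $ 1 $ 2 * sin \<tau>) + sin \<tau> * (A x $ 1 $ 2 * cos \<tau> + A x $ 2 $ 2 * sin \<tau>)"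
    "q = cos \<tau> * (A x $ 1 $ 2 * cos \<tau> - A x $ 1 $ 1 * sin \<tau>) + sin \<tau> * (A x $ 2 $ 2 * cos \<tau> - A x $ 1 $ 2 * sin \<tau>)"
    "k = cos \<tau> * (A x $ 2 $ 2 * cos \<tau> - A x $ 1 $ 2 * sin \<tau>) - sin \<tau> * (A x $ 1 $ 2 * cos \<tau> - A x $ 1 $ 1 * sin \<tau>)"
    unfolding p_def q_def k_def er_def et_def inner_vec_def matrix_vector_mult_def
    by (simp_all add: sum_2 A21)
  note entries = frame_entries[where x = "A x $ 1 $ 1" and y = "A x $ 1 $ 2" and z = "A x $ 2 $ 2", OF cs, folded pqk]
  have "(\<Sum>i\<in>UNIV. \<Sum>j\<in>UNIV. A x $ i $ j * H i j) =
    A x $ 1 $ 1 * H 1 1 + A x $ 1 $ 2 * H 1 2 + (A x $ 1 $ 2 * H 2 1 + A x $ 2 $ 2 * H 2 2)"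
    by (simp add: sum_2 A21)
  also have "\<dots> = p * ((cos \<tau> - z * sin \<tau>) * (cos \<tau> - z * sin \<tau>) * H 1 1
      + (cos \<tau> - z * sin \<tau>) * (sin \<tau> + z * cos \<tau>) * H 1 2
      + ((sin \<tau> + z * cos \<tau>) * (cos \<tau> - z * sin \<tau>) * H 2 1
      + (sin \<tau> + z * cos \<tau>) * (sin \<tau> + z * cos \<tau>) * H 2 2))
    + (k - z\<^sup>2 * p) * (sin \<tau> * sin \<tau> * H 1 1 - sin \<tau> * cos \<tau> * H 1 2
      + (cos \<tau> * cos \<tau> * H 2 2 - cos \<tau> * sin \<tau> * H 2 1))"
    unfolding entries z(1) by (rule rank_one_splitting)
  also have "\<dots> = p * HH (frame \<tau> 1 z) + (k - z\<^sup>2 * p) * HH (frame \<tau> 0 1)"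
    by (simp add: HH_def sum_2)
  also have "\<dots> \<le> p * (Q11 * 1\<^sup>2 + 2 * Q12 * 1 * z + Q22 * z\<^sup>2) + (k - z\<^sup>2 * p) * (Q11 * 0\<^sup>2 + 2 * Q12 * 0 * 1 + Q22 * 1\<^sup>2)"
    using test[of 1 z] test[of 0 1] p k z by (intro add_mono mult_left_mono) auto
  also have "\<dots> = p * Q11 + 2 * q * Q12 + k * Q22"
    by (simp add: z(1) algebra_simps)
  finally have 2: "(\<Sum>i\<in>UNIV. \<Sum>j\<in>UNIV. A x $ i $ j * H i j) \<le> p * Q11 + 2 * q * Q12 + k * Q22" .
  have "b x \<bullet> g = frame \<tau> (b x \<bullet> er) (b x \<bullet> et) \<bullet> g"
    unfolding er_def et_def by (subst frame_components[of "b x" \<tau>]) simp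
  also have "\<dots> = (b x \<bullet> er) * P1 + (b x \<bullet> et) * P2"
    using test[of "b x \<bullet> er" "b x \<bullet> et"] by (simp add: inner_commute mult.commute)
  finally have 1: "b x \<bullet> g = (b x \<bullet> er) * P1 + (b x \<bullet> et) * P2" .
  have "elliptic_op A b u1 x - elliptic_op A b u2 x =
    - (\<Sum>i\<in>UNIV. \<Sum>j\<in>UNIV. A x $ i $ j * H i j) + b x \<bullet> g"
    by (simp add: elliptic_op_def H_def g_def inner_diff_right right_diff_distrib sum_subtractf)
  with c 1 2 show ?thesis by linarith
qed

section \<open>Geometry of the spiral\<close>

lemma isCont_polar: "isCont (\<lambda>z. polar (fst z) (snd z)) z"
  unfolding isCont_def
proof (rule vec_tendstoI)
  show "((\<lambda>z. polar (fst z) (snd z) $ i) \<longlongrightarrow> polar (fst z) (snd z) $ i) (at z)" for i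
    using exhaust_2[of i]
    by (elim disjE; simp only: polar_def vector_2; intro tendsto_intros tendsto_ident_at)
qed

lemma continuous_on_polar [continuous_intros]:
  assumes "continuous_on X f" "continuous_on X g"
  shows "continuous_on X (\<lambda>x. polar (f x) (g x))"
  using continuous_on_compose2[OF continuous_at_imp_continuous_on[of UNIV "\<lambda>z. polar (fst z) (snd z)"]
      continuous_on_Pair[OF assms]]
  by (simp add: isCont_polar)

locale spiral =
  fixes \<theta>0 rs :: real and r1 r2 :: "real \<Rightarrow> real"
  assumes cont: "continuous_on {\<theta>0..} r1" "continuous_on {\<theta>0..} r2"
    and pos: "\<And>\<theta>. \<theta>0 \<le> \<theta> \<Longrightarrow> 0 < r1 \<theta>"
    and less: "\<And>\<theta>. \<theta>0 \<le> \<theta> \<Longrightarrow> r1 \<theta> < r2 \<theta>"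
    and rs: "0 < rs" and lim: "(r1 \<longlongrightarrow> rs) at_top" "(r2 \<longlongrightarrow> rs) at_top"
begin

abbreviation "U \<equiv> spiral_domain \<theta>0 r1 r2"
abbreviation "U' \<equiv> spiral_closed \<theta>0 r1 r2"
abbreviation "\<gamma> \<equiv> spiral_sides \<theta>0 r1 r2"
abbreviation "S \<equiv> spiral_section r1 r2"

lemma in_U: "\<theta>0 < \<theta> \<Longrightarrow> r1 \<theta> < r \<Longrightarrow> r < r2 \<theta> \<Longrightarrow> polar r \<theta> \<in> U"
  and in_U': "\<theta>0 \<le> \<theta> \<Longrightarrow> r1 \<theta> \<le> r \<Longrightarrow> r \<le> r2 \<theta> \<Longrightarrow> polar r \<theta> \<in> U'"
  and in_S: "r1 \<theta> \<le> r \<Longrightarrow> r \<le> r2 \<theta> \<Longrightarrow> polar r \<theta> \<in> S \<theta>"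
  and in_sides: "\<theta>0 \<le> \<theta> \<Longrightarrow> polar (r1 \<theta>) \<theta> \<in> \<gamma>" "\<theta>0 \<le> \<theta> \<Longrightarrow> polar (r2 \<theta>) \<theta> \<in> \<gamma>"
  unfolding spiral_domain_def spiral_closed_def spiral_section_def spiral_sides_def by blast+

lemma radius_bounds:
  obtains s R where "s > 0" "\<And>\<theta>. \<theta>0 \<le> \<theta> \<Longrightarrow> s \<le> r1 \<theta>" "\<And>\<theta>. \<theta>0 \<le> \<theta> \<Longrightarrow> r2 \<theta> \<le> R"
proof -
  have "\<forall>\<^sub>F \<theta> in at_top. rs / 2 < r1 \<theta> \<and> r2 \<theta> < 2 * rs"
    using order_tendstoD(1)[OF lim(1), of "rs / 2"] order_tendstoD(2)[OF lim(2), of "2 * rs"] rs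
    by (intro eventually_conj) auto
  then obtain T where T: "\<And>\<theta>. T \<le> \<theta> \<Longrightarrow> rs / 2 < r1 \<theta> \<and> r2 \<theta> < 2 * rs"
    by (auto simp: eventually_at_top_linorder)
  define T' where "T' = max T \<theta>0"
  have c: "continuous_on {\<theta>0..T'} r1" "continuous_on {\<theta>0..T'} r2"
    using cont by (auto intro: continuous_on_subset)
  have ne: "{\<theta>0..T'} \<noteq> {}" by (simp add: T'_def)
  obtain a where a: "a \<in> {\<theta>0..T'}" "\<And>\<theta>. \<theta> \<in> {\<theta>0..T'} \<Longrightarrow> r1 a \<le> r1 \<theta>"
    using continuous_attains_inf[OF compact_Icc ne c(1)] by blast
  obtain d where d: "\<And>\<theta>. \<theta> \<in> {\<theta>0..T'} \<Longrightarrow> r2 \<theta> \<le> r2 d"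
    using continuous_attains_sup[OF compact_Icc ne c(2)] by blast
  show ?thesis
  proof (rule that[of "min (r1 a) (rs / 2)" "max (r2 d) (2 * rs)"])
    show "0 < min (r1 a) (rs / 2)" using pos[of a] a(1) rs by auto
    fix \<theta> assume "\<theta>0 \<le> \<theta>"
    then consider "\<theta> \<in> {\<theta>0..T'}" | "T \<le> \<theta>" unfolding T'_def by fastforce
    then have "(r1 a \<le> r1 \<theta> \<and> r2 \<theta> \<le> r2 d) \<or> (rs / 2 < r1 \<theta> \<and> r2 \<theta> < 2 * rs)"
      by cases (blast intro: a(2) d, blast dest: T)
    then show "min (r1 a) (rs / 2) \<le> r1 \<theta>" "r2 \<theta> \<le> max (r2 d) (2 * rs)" by linarith+
  qed
qed

text \<open>Openness of the set of interior coordinates, in the form in which it is applied: to points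
  that move continuously, either along a line or over a whole neighbourhood.\<close>
lemma eventually_interior:
  assumes "(r \<longlongrightarrow> \<rho>) F" "(\<theta> \<longlongrightarrow> \<tau>) F" "\<theta>0 \<le> T" "T < \<tau>" "\<tau> < T'" "r1 \<tau> < \<rho>" "\<rho> < r2 \<tau>"
  shows "\<forall>\<^sub>F x in F. T < \<theta> x \<and> \<theta> x < T' \<and> r1 (\<theta> x) < r x \<and> r x < r2 (\<theta> x)"
proof -
  have \<tau>: "\<theta>0 < \<tau>" using assms by simp
  have "continuous_on {\<theta>0<..} r1" "continuous_on {\<theta>0<..} r2"
    using cont by (auto intro: continuous_on_subset)
  then have c: "isCont r1 \<tau>" "isCont r2 \<tau>"
    using \<tau> by (simp_all add: continuous_on_eq_continuous_at)
  note d = tendsto_diff[OF assms(1) isCont_tendsto_compose[OF c(1) assms(2)]]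
    tendsto_diff[OF isCont_tendsto_compose[OF c(2) assms(2)] assms(1)]
  have "\<forall>\<^sub>F x in F. 0 < r x - r1 (\<theta> x)"
    by (rule order_tendstoD(1)[OF d(1)]) (use assms(6) in simp)
  moreover have "\<forall>\<^sub>F x in F. 0 < r2 (\<theta> x) - r x"
    by (rule order_tendstoD(1)[OF d(2)]) (use assms(7) in simp)
  moreover have "\<forall>\<^sub>F x in F. T < \<theta> x" by (rule order_tendstoD(1)[OF assms(2,4)])
  moreover have "\<forall>\<^sub>F x in F. \<theta> x < T'" by (rule order_tendstoD(2)[OF assms(2,5)])
  ultimately show ?thesis by eventually_elim simp
qed

text \<open>Near a point of the spiral, the functions \<open>sqrt (X\<^sup>2 + Y\<^sup>2)\<close> and \<open>\<tau> + arctan (Y / X)\<close> of the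
  components in the frame at that point are polar coordinates that depend continuously on the
  point and start at the given pair, so they stay in the admissible range.\<close>
lemma open_U: "open U"
proof (subst open_subopen, intro ballI)
  fix x0 assume "x0 \<in> U"
  then obtain \<rho> \<tau> where x0: "x0 = polar \<rho> \<tau>" "\<theta>0 < \<tau>" "r1 \<tau> < \<rho>" "\<rho> < r2 \<tau>"
    by (auto simp: spiral_domain_def)
  have \<rho>: "\<rho> > 0" using pos[of \<tau>] x0 by simp
  let ?X = "\<lambda>x. x \<bullet> frame \<tau> 1 0" and ?Y = "\<lambda>x. x \<bullet> frame \<tau> 0 1"
  have "?X x0 = \<rho> * ((cos \<tau>)\<^sup>2 + (sin \<tau>)\<^sup>2)" "?Y x0 = 0"
    unfolding x0(1) polar_eq_frame inner_vec_def by (simp_all add: sum_2 power2_eq_square algebra_simps del: sin_cos_squared_add3)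
  then have "(?X \<longlongrightarrow> \<rho>) (nhds x0)" "(?Y \<longlongrightarrow> 0) (nhds x0)"
    using tendsto_inner[OF filterlim_ident[of "nhds x0"] tendsto_const[of "frame \<tau> 1 0"]]
      tendsto_inner[OF filterlim_ident[of "nhds x0"] tendsto_const[of "frame \<tau> 0 1"]] by simp_all
  note lim = this
  have "((\<lambda>x. sqrt ((?X x)\<^sup>2 + (?Y x)\<^sup>2)) \<longlongrightarrow> sqrt (\<rho>\<^sup>2 + 0\<^sup>2)) (nhds x0)"
    by (intro tendsto_intros lim)
  moreover have "((\<lambda>x. \<tau> + arctan (?Y x / ?X x)) \<longlongrightarrow> \<tau> + arctan (0 / \<rho>)) (nhds x0)"
    by (intro tendsto_intros lim) (use \<rho> in simp)
  ultimately have "\<forall>\<^sub>F x in nhds x0. \<theta>0 < \<tau> + arctan (?Y x / ?X x) \<and> \<tau> + arctan (?Y x / ?X x) < \<tau> + 1 \<and>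
      r1 (\<tau> + arctan (?Y x / ?X x)) < sqrt ((?X x)\<^sup>2 + (?Y x)\<^sup>2) \<and>
      sqrt ((?X x)\<^sup>2 + (?Y x)\<^sup>2) < r2 (\<tau> + arctan (?Y x / ?X x))"
    using x0 \<rho> by (intro eventually_interior[where \<rho> = \<rho> and \<tau> = \<tau>]) auto
  moreover have "\<forall>\<^sub>F x in nhds x0. 0 < ?X x" using lim(1) \<rho> by (rule order_tendstoD)
  ultimately have "\<forall>\<^sub>F x in nhds x0. x \<in> U"
  proof eventually_elim
    case (elim x)
    have "x = frame \<tau> (?X x) (?Y x)" by (rule frame_components)
    also have "\<dots> = polar (sqrt ((?X x)\<^sup>2 + (?Y x)\<^sup>2)) (\<tau> + arctan (?Y x / ?X x))"
      using elim by (intro frame_eq_polar) simp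
    also have "\<dots> \<in> U" using elim by (intro in_U) auto
    finally show ?case .
  qed
  then show "\<exists>T. open T \<and> x0 \<in> T \<and> T \<subseteq> U"
    unfolding eventually_nhds by blast
qed

lemma bdd_above_section:
  fixes u :: "real^2 \<Rightarrow> real"
  assumes "continuous_on U' u" "\<theta>0 \<le> \<theta>"
  shows "bdd_above ((\<lambda>x. \<bar>u x\<bar>) ` S \<theta>)"
proof -
  have "continuous_on {r1 \<theta>..r2 \<theta>} (\<lambda>r. polar r \<theta>)" by (intro continuous_intros)
  then have "compact ((\<lambda>r. polar r \<theta>) ` {r1 \<theta>..r2 \<theta>})" by (rule compact_continuous_image) simp
  also have "(\<lambda>r. polar r \<theta>) ` {r1 \<theta>..r2 \<theta>} = S \<theta>" by (auto simp: spiral_section_def)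
  finally have "compact (S \<theta>)" .
  moreover have "S \<theta> \<subseteq> U'" using assms(2) by (auto simp: spiral_section_def in_U')
  ultimately have "compact ((\<lambda>x. \<bar>u x\<bar>) ` S \<theta>)"
    using compact_continuous_image[OF continuous_on_rabs[OF continuous_on_subset[OF assms(1)]]] by blast
  then show ?thesis by (intro bounded_imp_bdd_above compact_imp_bounded)
qed

text \<open>Continuity makes \<open>u\<close> bounded on every section, so that the real supremum in the growth
  condition is indeed an upper bound.\<close>
lemma below_exp_growthD:
  assumes "below_exp_growth r1 r2 u" "continuous_on U' u" "\<nu> > 0" "\<epsilon> > 0"
  shows "\<forall>\<^sub>F \<theta> in at_top. \<forall>r\<in>{r1 \<theta>..r2 \<theta>}. \<bar>u (polar r \<theta>)\<bar> \<le> \<epsilon> * exp (\<nu> * \<theta>)"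
proof -
  have "((\<lambda>\<theta>. exp (- \<nu> * \<theta>) * (SUP x\<in>S \<theta>. \<bar>u x\<bar>)) \<longlongrightarrow> 0) at_top"
    using assms unfolding below_exp_growth_def by blast
  then have "\<forall>\<^sub>F \<theta> in at_top. exp (- \<nu> * \<theta>) * (SUP x\<in>S \<theta>. \<bar>u x\<bar>) < \<epsilon>"
    using assms(4) by (rule order_tendstoD)
  then show ?thesis using eventually_ge_at_top[of \<theta>0]
  proof eventually_elim
    case (elim \<theta>)
    have "(SUP x\<in>S \<theta>. \<bar>u x\<bar>) \<le> \<epsilon> * exp (\<nu> * \<theta>)"
      using elim(1) by (simp add: exp_minus field_simps)
    then show ?case
      using cSUP_upper[OF in_S bdd_above_section[OF assms(2) elim(2)]]
      by (meson atLeastAtMost_iff order_trans)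
  qed
qed

end

section \<open>Comparison\<close>

locale spiral_operator = spiral +
  fixes A :: "real^2 \<Rightarrow> real^2^2" and b :: "real^2 \<Rightarrow> real^2" and c0 M1 M2 :: real
  assumes sym: "\<And>x. x \<in> U \<Longrightarrow> transpose (A x) = A x"
    and constants: "0 < c0" "0 < M1" "0 \<le> M2"
    and elliptic: "\<And>x \<xi>. x \<in> U \<Longrightarrow> c0 * (norm \<xi>)\<^sup>2 \<le> \<xi> \<bullet> (A x *v \<xi>)"
    and trace: "\<And>x. x \<in> U \<Longrightarrow> trace (A x) \<le> M1"
    and drift: "\<And>x. x \<in> U \<Longrightarrow> norm (b x) \<le> M2"
begin

text \<open>Comparison on the part of the spiral between two sections. The compact set of coordinate
  pairs, rather than its image in the plane, carries the maximum, because \<open>W\<close> is a function of the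
  coordinates. A maximum with positive value avoids the boundary by the hypothesis there, and at an
  interior one the second derivative test contradicts strictness.\<close>
lemma comparison:
  assumes u: "C2_on U u1" "C2_on U u2" "continuous_on U' u1" "continuous_on U' u2"
    and T: "\<theta>0 \<le> T" "T \<le> T'"
    and W_cont: "continuous_on UNIV (\<lambda>z. W (fst z) (snd z))"
    and W: "\<And>\<rho> \<tau>. \<lbrakk>T < \<tau>; r1 \<tau> < \<rho>; \<rho> < r2 \<tau>\<rbrakk> \<Longrightarrow>
      polar_op_ge (A (polar \<rho> \<tau>)) (b (polar \<rho> \<tau>)) W \<rho> \<tau> (G \<rho> \<tau>)"
    and strict: "\<And>\<rho> \<tau>. \<lbrakk>T < \<tau>; r1 \<tau> < \<rho>; \<rho> < r2 \<tau>\<rbrakk> \<Longrightarrow>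
      elliptic_op A b u1 (polar \<rho> \<tau>) - elliptic_op A b u2 (polar \<rho> \<tau>) < G \<rho> \<tau>"
    and bd: "\<And>r \<theta>. \<lbrakk>T \<le> \<theta>; \<theta> \<le> T'; r1 \<theta> \<le> r; r \<le> r2 \<theta>; \<theta> = T \<or> \<theta> = T' \<or> r = r1 \<theta> \<or> r = r2 \<theta>\<rbrakk> \<Longrightarrow>
      u1 (polar r \<theta>) - u2 (polar r \<theta>) \<le> W r \<theta>"
    and pt: "T \<le> \<theta>" "\<theta> \<le> T'" "r1 \<theta> \<le> r" "r \<le> r2 \<theta>"
  shows "u1 (polar r \<theta>) - u2 (polar r \<theta>) \<le> W r \<theta>"
proof (rule ccontr)
  assume neg: "\<not> ?thesis"
  define K where "K = {z. T \<le> snd z \<and> snd z \<le> T' \<and> r1 (snd z) \<le> fst z \<and> fst z \<le> r2 (snd z)}"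
  define \<phi> where "\<phi> z = u1 (polar (fst z) (snd z)) - u2 (polar (fst z) (snd z)) - W (fst z) (snd z)" for z
  have K: "compact K"
  proof -
    let ?f = "\<lambda>z. ((1 - fst z) * r1 (snd z) + fst z * r2 (snd z), snd z)"
    have "continuous_on ({0..1} \<times> {T..T'}) (\<lambda>z. r1 (snd z))" "continuous_on ({0..1} \<times> {T..T'}) (\<lambda>z. r2 (snd z))"
      using T by (auto intro!: continuous_on_compose2[OF cont(1)] continuous_on_compose2[OF cont(2)] continuous_intros)
    then have "continuous_on ({0..1} \<times> {T..T'}) ?f"
      by (intro continuous_intros)
    then have "compact (?f ` ({0..1} \<times> {T..T'}))"
      by (rule compact_continuous_image) (intro compact_Times compact_Icc)
    also have "?f ` ({0..1} \<times> {T..T'}) = K"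
    proof (intro set_eqI iffI)
      fix z assume "z \<in> ?f ` ({0..1} \<times> {T..T'})"
      then obtain s \<tau> where z: "z = ((1 - s) * r1 \<tau> + s * r2 \<tau>, \<tau>)" "0 \<le> s" "s \<le> 1" "T \<le> \<tau>" "\<tau> \<le> T'"
        by auto
      have "r1 \<tau> < r2 \<tau>" using z T by (intro less) simp
      then have "s * (r2 \<tau> - r1 \<tau>) \<ge> 0" "(1 - s) * (r2 \<tau> - r1 \<tau>) \<ge> 0" using z by auto
      then show "z \<in> K" using z by (simp add: K_def algebra_simps)
    next
      fix z assume z: "z \<in> K"
      have lt: "r1 (snd z) < r2 (snd z)" using z T by (intro less) (simp add: K_def)
      define s where "s = (fst z - r1 (snd z)) / (r2 (snd z) - r1 (snd z))"
      have "s * (r2 (snd z) - r1 (snd z)) = fst z - r1 (snd z)" using lt by (simp add: s_def)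
      then have "z = ?f (s, snd z)" by (simp add: prod_eq_iff algebra_simps)
      moreover have "(s, snd z) \<in> {0..1} \<times> {T..T'}" using z lt by (auto simp: s_def K_def field_simps)
      ultimately show "z \<in> ?f ` ({0..1} \<times> {T..T'})" by (rule image_eqI)
    qed
    finally show ?thesis .
  qed
  have \<phi>: "continuous_on K \<phi>"
  proof -
    have "continuous_on K (\<lambda>z. polar (fst z) (snd z))" by (intro continuous_intros)
    moreover have "(\<lambda>z. polar (fst z) (snd z)) ` K \<subseteq> U'"
      using T by (auto simp: K_def intro!: in_U')
    ultimately show ?thesis unfolding \<phi>_def
      using continuous_on_compose2[OF u(3)] continuous_on_compose2[OF u(4)] continuous_on_subset[OF W_cont]
      by (intro continuous_on_diff) auto
  qed
  have rt: "(r, \<theta>) \<in> K" using pt by (simp add: K_def)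
  obtain z0 where z0: "z0 \<in> K" and z0_max: "\<And>z. z \<in> K \<Longrightarrow> \<phi> z \<le> \<phi> z0"
    using continuous_attains_sup[OF K _ \<phi>] rt by blast
  obtain \<rho> \<tau> where z0_eq: "z0 = (\<rho>, \<tau>)" by (cases z0)
  have "0 < \<phi> (r, \<theta>)" using neg by (simp add: \<phi>_def)
  with z0_max[OF rt] have pos_max: "0 < \<phi> (\<rho>, \<tau>)" by (simp add: z0_eq)
  have in_K: "T \<le> \<tau>" "\<tau> \<le> T'" "r1 \<tau> \<le> \<rho>" "\<rho> \<le> r2 \<tau>" using z0 by (auto simp: K_def z0_eq)
  have int: "T < \<tau>" "\<tau> < T'" "r1 \<tau> < \<rho>" "\<rho> < r2 \<tau>"
    using bd[OF in_K] in_K pos_max by (auto simp: \<phi>_def less_le)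
  have \<rho>: "\<rho> > 0" using pos[of \<tau>] int T by simp
  define x where "x = polar \<rho> \<tau>"
  have x: "x \<in> U" unfolding x_def using int T by (intro in_U) auto
  have "G \<rho> \<tau> \<le> elliptic_op A b u1 x - elliptic_op A b u2 x"
  proof (rule touching_from_above[where A = A and b = b and x = x, OF open_U u(1,2) \<rho> x_def x sym[OF x]])
    show "0 < \<xi> \<bullet> (A x *v \<xi>)" if "\<xi> \<noteq> 0" for \<xi>
      using elliptic[OF x, of \<xi>] that constants(1) by (meson less_le_trans mult_pos_pos zero_less_norm_iff zero_less_power)
    show "polar_op_ge (A x) (b x) W \<rho> \<tau> (G \<rho> \<tau>)" unfolding x_def by (rule W[OF int(1,3,4)])
    fix \<alpha> \<beta>
    let ?r = "line_radius \<rho> \<alpha> \<beta>" and ?\<theta> = "line_angle \<rho> \<tau> \<alpha> \<beta>"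
    have "(?r \<longlongrightarrow> ?r 0) (nhds 0)" "(?\<theta> \<longlongrightarrow> ?\<theta> 0) (nhds 0)"
      by (rule jet2_tendsto[OF jet2_line_radius[OF \<rho>]], rule jet2_tendsto[OF jet2_line_angle[OF \<rho>]])
    then have "\<forall>\<^sub>F t in nhds 0. T < ?\<theta> t \<and> ?\<theta> t < T' \<and> r1 (?\<theta> t) < ?r t \<and> ?r t < r2 (?\<theta> t)"
      using int T \<rho> by (intro eventually_interior[of _ \<rho> _ _ \<tau>]) auto
    with eventually_line_polar[OF \<rho>, of \<tau> \<alpha> \<beta>]
    show "\<forall>\<^sub>F t in nhds 0. u1 (x + t *\<^sub>R frame \<tau> \<alpha> \<beta>) - u2 (x + t *\<^sub>R frame \<tau> \<alpha> \<beta>) - W (?r t) (?\<theta> t)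
      \<le> u1 x - u2 x - W \<rho> \<tau>"
    proof eventually_elim
      case (elim t)
      then have "(?r t, ?\<theta> t) \<in> K" by (simp add: K_def)
      from z0_max[OF this] elim show ?case by (simp add: \<phi>_def z0_eq x_def)
    qed
  qed
  with strict[OF int(1,3,4)] show False by (simp add: x_def)
qed

end

section \<open>Estimates for differences of solutions\<close>

lemma bdd_above_abs_diff:
  fixes f g :: "'a \<Rightarrow> real"
  assumes "bounded (f ` X)" "bounded (g ` X)"
  shows "bdd_above ((\<lambda>x. \<bar>f x - g x\<bar>) ` X)"
  using bounded_minus_comp[OF assms] by (simp add: bdd_above_norm[symmetric] image_image)

text \<open>Fixing one choice of barrier constants keeps them out of the statements of the estimates;
  the constants of the theorem are read off from \<open>\<delta>\<close> and \<open>\<nu>\<close>.\<close>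
locale spiral_barrier = spiral_operator +
  fixes \<alpha> \<delta> \<nu> R :: real
  assumes c: "0 \<le> \<alpha>" "0 < \<delta>" "0 < \<nu>"
    and R: "\<And>\<theta>. \<theta>0 \<le> \<theta> \<Longrightarrow> r2 \<theta> \<le> R"
    and super: "\<And>\<mu> \<rho> \<tau>. \<lbrakk>\<theta>0 < \<tau>; r1 \<tau> < \<rho>; \<rho> < r2 \<tau>; \<bar>\<mu>\<bar> \<le> \<nu>\<rbrakk> \<Longrightarrow>
      polar_op_ge (A (polar \<rho> \<tau>)) (b (polar \<rho> \<tau>)) (barrier \<alpha> R \<mu>) \<rho> \<tau> (\<delta> * exp (\<mu> * \<tau>))"

lemma (in spiral_operator) obtain_barrier:
  obtains \<alpha> \<delta> \<nu> R where "spiral_barrier \<theta>0 rs r1 r2 A b c0 M1 M2 \<alpha> \<delta> \<nu> R"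
proof -
  obtain s R where sR: "s > 0" "\<And>\<theta>. \<theta>0 \<le> \<theta> \<Longrightarrow> s \<le> r1 \<theta>" "\<And>\<theta>. \<theta>0 \<le> \<theta> \<Longrightarrow> r2 \<theta> \<le> R"
    by (rule radius_bounds) blast
  obtain \<alpha> \<delta> \<nu> where c: "\<alpha> \<ge> 0" "\<delta> > 0" "\<nu> > 0" and
    super: "\<And>B \<beta> \<mu> \<rho> \<tau>. \<lbrakk>transpose B = B; \<And>\<xi>. c0 * (norm \<xi>)\<^sup>2 \<le> \<xi> \<bullet> (B *v \<xi>); trace B \<le> M1;
       norm \<beta> \<le> M2; s \<le> \<rho>; \<rho> \<le> R; \<bar>\<mu>\<bar> \<le> \<nu>\<rbrakk>
     \<Longrightarrow> polar_op_ge B \<beta> (barrier \<alpha> R \<mu>) \<rho> \<tau> (\<delta> * exp (\<mu> * \<tau>))"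
    by (rule barrier_strict_supersolution[OF constants sR(1), of R]) blast
  have "polar_op_ge (A (polar \<rho> \<tau>)) (b (polar \<rho> \<tau>)) (barrier \<alpha> R \<mu>) \<rho> \<tau> (\<delta> * exp (\<mu> * \<tau>))"
    if "\<theta>0 < \<tau>" "r1 \<tau> < \<rho>" "\<rho> < r2 \<tau>" "\<bar>\<mu>\<bar> \<le> \<nu>" for \<mu> \<rho> \<tau>
  proof -
    have x: "polar \<rho> \<tau> \<in> U" using that by (intro in_U) auto
    have \<rho>: "s \<le> \<rho>" "\<rho> \<le> R" using sR(2)[of \<tau>] sR(3)[of \<tau>] that by auto
    show ?thesis by (rule super[OF sym[OF x] elliptic[OF x] trace[OF x] drift[OF x] \<rho> that(4)])
  qed
  with c sR(3) have "spiral_barrier \<theta>0 rs r1 r2 A b c0 M1 M2 \<alpha> \<delta> \<nu> R"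
    by unfold_locales auto
  then show ?thesis by (rule that)
qed

context spiral_barrier
begin

text \<open>The term of size \<open>\<epsilon>\<close> in the comparison function controls the remote sections through the
  growth condition and makes the supersolution strict; it disappears in the limit \<open>\<epsilon> \<rightarrow> 0\<close> at a
  fixed angle. The starting angle \<open>T\<close> is kept free for the sake of the upper limits.\<close>
lemma one_sided_estimate:
  assumes u: "C2_on U u1" "C2_on U u2" "continuous_on U' u1" "continuous_on U' u2"
    and growth: "below_exp_growth r1 r2 u1" "below_exp_growth r1 r2 u2"
    and T: "\<theta>0 \<le> T" and nonneg: "0 \<le> m" "0 \<le> F" "0 \<le> n"
    and side1: "\<And>\<theta>. T \<le> \<theta> \<Longrightarrow> u1 (polar (r1 \<theta>) \<theta>) - u2 (polar (r1 \<theta>) \<theta>) \<le> m"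
    and side2: "\<And>\<theta>. T \<le> \<theta> \<Longrightarrow> u1 (polar (r2 \<theta>) \<theta>) - u2 (polar (r2 \<theta>) \<theta>) \<le> m"
    and start: "\<And>r. \<lbrakk>r1 T \<le> r; r \<le> r2 T\<rbrakk> \<Longrightarrow> u1 (polar r T) - u2 (polar r T) \<le> n"
    and rhs: "\<And>r \<theta>. \<lbrakk>T < \<theta>; r1 \<theta> < r; r < r2 \<theta>\<rbrakk> \<Longrightarrow>
        elliptic_op A b u1 (polar r \<theta>) - elliptic_op A b u2 (polar r \<theta>) \<le> F"
    and pt: "T \<le> \<theta>" "r1 \<theta> \<le> r" "r \<le> r2 \<theta>"
  shows "u1 (polar r \<theta>) - u2 (polar r \<theta>) \<le> m + 2 / \<delta> * F + 2 * n * exp (- \<nu> * (\<theta> - T))"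
proof -
  have bds: "exp (\<mu> * \<theta>) \<le> barrier \<alpha> R \<mu> r \<theta>" "barrier \<alpha> R \<mu> r \<theta> \<le> 2 * exp (\<mu> * \<theta>)" "0 \<le> barrier \<alpha> R \<mu> r \<theta>"
    if "T \<le> \<theta>" "r \<le> r2 \<theta>" for \<mu> r \<theta>
  proof -
    have "r \<le> R" using R[of \<theta>] that T by simp
    with c(1) show 1: "exp (\<mu> * \<theta>) \<le> barrier \<alpha> R \<mu> r \<theta>" "barrier \<alpha> R \<mu> r \<theta> \<le> 2 * exp (\<mu> * \<theta>)"
      by (intro barrier_bounds; simp)+
    show "0 \<le> barrier \<alpha> R \<mu> r \<theta>" by (rule order_trans[OF _ 1(1)]) simp
  qed
  have approx: "u1 (polar r \<theta>) - u2 (polar r \<theta>) \<le> (m + 2 / \<delta> * F + 2 * n * exp (- \<nu> * (\<theta> - T))) + \<epsilon> * (4 * exp (\<nu> * \<theta>))"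
    if \<epsilon>: "\<epsilon> > 0" for \<epsilon>
  proof -
    \<comment> \<open>The factor 2 accounts for the two solutions, each of which is eventually below \<open>\<epsilon> e\<^sup>\<nu>\<^sup>\<theta>\<close>.\<close>
    define W where "W r \<theta> = m + (F / \<delta> * barrier \<alpha> R 0 r \<theta> + (n * exp (\<nu> * T) * barrier \<alpha> R (- \<nu>) r \<theta>
        + 2 * \<epsilon> * barrier \<alpha> R \<nu> r \<theta>))" for r \<theta>
    have parts: "0 \<le> F / \<delta> * barrier \<alpha> R 0 r \<theta>" "0 \<le> n * exp (\<nu> * T) * barrier \<alpha> R (- \<nu>) r \<theta>"
      "0 \<le> 2 * \<epsilon> * barrier \<alpha> R \<nu> r \<theta>" if "T \<le> \<theta>" "r \<le> r2 \<theta>" for r \<theta>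
      using bds(3)[OF that] nonneg c \<epsilon> by auto
    have "\<forall>\<^sub>F \<theta> in at_top. \<forall>r\<in>{r1 \<theta>..r2 \<theta>}. \<bar>u1 (polar r \<theta>)\<bar> \<le> \<epsilon> * exp (\<nu> * \<theta>)"
      "\<forall>\<^sub>F \<theta> in at_top. \<forall>r\<in>{r1 \<theta>..r2 \<theta>}. \<bar>u2 (polar r \<theta>)\<bar> \<le> \<epsilon> * exp (\<nu> * \<theta>)"
      by (rule below_exp_growthD[OF growth(1) u(3) c(3) \<epsilon>], rule below_exp_growthD[OF growth(2) u(4) c(3) \<epsilon>])
    from eventually_conj[OF this] obtain N where
      "\<forall>\<theta>\<ge>N. (\<forall>r\<in>{r1 \<theta>..r2 \<theta>}. \<bar>u1 (polar r \<theta>)\<bar> \<le> \<epsilon> * exp (\<nu> * \<theta>)) \<and>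
        (\<forall>r\<in>{r1 \<theta>..r2 \<theta>}. \<bar>u2 (polar r \<theta>)\<bar> \<le> \<epsilon> * exp (\<nu> * \<theta>))"
      unfolding eventually_at_top_linorder by blast
    then have N: "\<bar>u1 (polar r \<theta>)\<bar> \<le> \<epsilon> * exp (\<nu> * \<theta>) \<and> \<bar>u2 (polar r \<theta>)\<bar> \<le> \<epsilon> * exp (\<nu> * \<theta>)"
      if "N \<le> \<theta>" "r1 \<theta> \<le> r" "r \<le> r2 \<theta>" for \<theta> r
      using that by simp
    define T' where "T' = max N \<theta>"
    have "u1 (polar r \<theta>) - u2 (polar r \<theta>) \<le> W r \<theta>"
    proof (rule comparison[OF u T, where T' = T' and G = "\<lambda>\<rho> \<tau>. F + n * exp (\<nu> * T) * (\<delta> * exp (- \<nu> * \<tau>)) + 2 * \<epsilon> * (\<delta> * exp (\<nu> * \<tau>))"])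
      show "T \<le> T'" "T \<le> \<theta>" "\<theta> \<le> T'" "r1 \<theta> \<le> r" "r \<le> r2 \<theta>" using pt by (auto simp: T'_def)
      show "continuous_on UNIV (\<lambda>z. W (fst z) (snd z))"
        unfolding W_def by (intro continuous_intros continuous_on_barrier)
    next
      fix \<rho> \<tau> assume int: "T < \<tau>" "r1 \<tau> < \<rho>" "\<rho> < r2 \<tau>"
      have \<tau>: "\<theta>0 < \<tau>" using int T by simp
      note b = super[OF \<tau> int(2,3)]
      have "polar_op_ge (A (polar \<rho> \<tau>)) (b (polar \<rho> \<tau>)) W \<rho> \<tau>
        (0 + (F / \<delta> * (\<delta> * exp (0 * \<tau>)) + (n * exp (\<nu> * T) * (\<delta> * exp (- \<nu> * \<tau>)) + 2 * \<epsilon> * (\<delta> * exp (\<nu> * \<tau>)))))"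
        unfolding W_def using c nonneg \<epsilon>
        by (intro polar_op_ge_add polar_op_ge_const polar_op_ge_scale b) auto
      then show "polar_op_ge (A (polar \<rho> \<tau>)) (b (polar \<rho> \<tau>)) W \<rho> \<tau>
        (F + n * exp (\<nu> * T) * (\<delta> * exp (- \<nu> * \<tau>)) + 2 * \<epsilon> * (\<delta> * exp (\<nu> * \<tau>)))"
        using c by (simp add: add.assoc)
      have "0 \<le> n * exp (\<nu> * T) * (\<delta> * exp (- \<nu> * \<tau>))" "0 < 2 * \<epsilon> * (\<delta> * exp (\<nu> * \<tau>))"
        using c nonneg \<epsilon> by auto
      with rhs[OF int] show "elliptic_op A b u1 (polar \<rho> \<tau>) - elliptic_op A b u2 (polar \<rho> \<tau>)
        < F + n * exp (\<nu> * T) * (\<delta> * exp (- \<nu> * \<tau>)) + 2 * \<epsilon> * (\<delta> * exp (\<nu> * \<tau>))"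
        by linarith
    next
      fix r \<theta> assume K: "T \<le> \<theta>" "\<theta> \<le> T'" "r1 \<theta> \<le> r" "r \<le> r2 \<theta>"
        and "\<theta> = T \<or> \<theta> = T' \<or> r = r1 \<theta> \<or> r = r2 \<theta>"
      then consider "\<theta> = T" | "\<theta> = T'" | "r = r1 \<theta> \<or> r = r2 \<theta>" by blast
      then show "u1 (polar r \<theta>) - u2 (polar r \<theta>) \<le> W r \<theta>"
      proof cases
        case 1
        have "n = n * exp (\<nu> * T) * exp (- \<nu> * T)" by (simp flip: exp_add)
        also have "\<dots> \<le> n * exp (\<nu> * T) * barrier \<alpha> R (- \<nu>) r \<theta>"
          using bds(1)[OF K(1,4), of "- \<nu>"] nonneg unfolding 1 by (intro mult_left_mono) auto
        finally show ?thesis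
          using start[of r] K parts[OF K(1,4)] nonneg unfolding W_def 1 by linarith
      next
        case 2
        have "N \<le> \<theta>" using 2 by (simp add: T'_def)
        from N[OF this K(3,4)] have "u1 (polar r \<theta>) - u2 (polar r \<theta>) \<le> 2 * \<epsilon> * exp (\<nu> * \<theta>)" by linarith
        also have "\<dots> \<le> 2 * \<epsilon> * barrier \<alpha> R \<nu> r \<theta>"
          using bds(1)[OF K(1,4)] \<epsilon> by (intro mult_left_mono) auto
        finally show ?thesis
          using parts[OF K(1,4)] nonneg unfolding W_def by linarith
      next
        case 3
        then have "u1 (polar r \<theta>) - u2 (polar r \<theta>) \<le> m" using side1[OF K(1)] side2[OF K(1)] by auto
        then show ?thesis using parts[OF K(1,4)] unfolding W_def by linarith
      qed
    qed
    also have "W r \<theta> \<le> m + (F / \<delta> * (2 * exp (0 * \<theta>)) + (n * exp (\<nu> * T) * (2 * exp (- \<nu> * \<theta>)) + 2 * \<epsilon> * (2 * exp (\<nu> * \<theta>))))"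
      unfolding W_def using nonneg c \<epsilon> bds(2)[OF pt(1,3), of 0] bds(2)[OF pt(1,3), of \<nu>] bds(2)[OF pt(1,3), of "- \<nu>"]
      by (intro add_mono mult_left_mono order_refl) auto
    also have "\<dots> = (m + 2 / \<delta> * F + 2 * n * exp (- \<nu> * (\<theta> - T))) + \<epsilon> * (4 * exp (\<nu> * \<theta>))"
    proof -
      have "exp (- \<nu> * (\<theta> - T)) = exp (\<nu> * T) * exp (- \<nu> * \<theta>)"
        by (simp flip: exp_add add: algebra_simps)
      then show ?thesis by simp
    qed
    finally show ?thesis .
  qed
  show "u1 (polar r \<theta>) - u2 (polar r \<theta>) \<le> m + 2 / \<delta> * F + 2 * n * exp (- \<nu> * (\<theta> - T))"
  proof (rule field_le_epsilon)
    fix e :: real assume "e > 0"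
    then show "u1 (polar r \<theta>) - u2 (polar r \<theta>) \<le> m + 2 / \<delta> * F + 2 * n * exp (- \<nu> * (\<theta> - T)) + e"
      using approx[of "e / (4 * exp (\<nu> * \<theta>))"] by simp
  qed
qed

lemma two_sided_estimate:
  assumes u: "C2_on U u1" "C2_on U u2" "continuous_on U' u1" "continuous_on U' u2"
    and growth: "below_exp_growth r1 r2 u1" "below_exp_growth r1 r2 u2"
    and T: "\<theta>0 \<le> T" and nonneg: "0 \<le> m" "0 \<le> F" "0 \<le> n"
    and side1: "\<And>\<theta>. T \<le> \<theta> \<Longrightarrow> \<bar>u1 (polar (r1 \<theta>) \<theta>) - u2 (polar (r1 \<theta>) \<theta>)\<bar> \<le> m"
    and side2: "\<And>\<theta>. T \<le> \<theta> \<Longrightarrow> \<bar>u1 (polar (r2 \<theta>) \<theta>) - u2 (polar (r2 \<theta>) \<theta>)\<bar> \<le> m"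
    and start: "\<And>r. \<lbrakk>r1 T \<le> r; r \<le> r2 T\<rbrakk> \<Longrightarrow> \<bar>u1 (polar r T) - u2 (polar r T)\<bar> \<le> n"
    and rhs: "\<And>r \<theta>. \<lbrakk>T < \<theta>; r1 \<theta> < r; r < r2 \<theta>\<rbrakk> \<Longrightarrow>
        \<bar>elliptic_op A b u1 (polar r \<theta>) - elliptic_op A b u2 (polar r \<theta>)\<bar> \<le> F"
    and \<theta>: "T \<le> \<theta>"
  shows "(SUP x\<in>S \<theta>. \<bar>u1 x - u2 x\<bar>) \<le> m + 2 / \<delta> * F + 2 * n * exp (- \<nu> * (\<theta> - T))"
proof (rule cSUP_least)
  have "r1 \<theta> \<le> r2 \<theta>" using less[of \<theta>] T \<theta> by simp
  then show "S \<theta> \<noteq> {}" using in_S[of \<theta> "r1 \<theta>"] by auto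
  fix x assume "x \<in> S \<theta>"
  then obtain r where x: "x = polar r \<theta>" and r: "r1 \<theta> \<le> r" "r \<le> r2 \<theta>"
    by (auto simp: spiral_section_def)
  show "\<bar>u1 x - u2 x\<bar> \<le> m + 2 / \<delta> * F + 2 * n * exp (- \<nu> * (\<theta> - T))"
    unfolding x
  proof (rule abs_leI)
    show "u1 (polar r \<theta>) - u2 (polar r \<theta>) \<le> m + 2 / \<delta> * F + 2 * n * exp (- \<nu> * (\<theta> - T))"
      by (rule one_sided_estimate[OF u growth T nonneg abs_le_D1[OF side1] abs_le_D1[OF side2]
            abs_le_D1[OF start] abs_le_D1[OF rhs] \<theta> r])
    have side1': "u2 (polar (r1 \<theta>) \<theta>) - u1 (polar (r1 \<theta>) \<theta>) \<le> m" if "T \<le> \<theta>" for \<theta>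
      using side1[OF that] by linarith
    have side2': "u2 (polar (r2 \<theta>) \<theta>) - u1 (polar (r2 \<theta>) \<theta>) \<le> m" if "T \<le> \<theta>" for \<theta>
      using side2[OF that] by linarith
    have start': "u2 (polar r T) - u1 (polar r T) \<le> n" if "r1 T \<le> r" "r \<le> r2 T" for r
      using start[OF that] by linarith
    have rhs': "elliptic_op A b u2 (polar r \<theta>) - elliptic_op A b u1 (polar r \<theta>) \<le> F"
      if "T < \<theta>" "r1 \<theta> < r" "r < r2 \<theta>" for r \<theta>
      using rhs[OF that] by linarith
    have "u2 (polar r \<theta>) - u1 (polar r \<theta>) \<le> m + 2 / \<delta> * F + 2 * n * exp (- \<nu> * (\<theta> - T))"
      by (rule one_sided_estimate[OF u(2,1,4,3) growth(2,1) T nonneg side1' side2' start' rhs' \<theta> r])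
    then show "- (u1 (polar r \<theta>) - u2 (polar r \<theta>)) \<le> m + 2 / \<delta> * F + 2 * n * exp (- \<nu> * (\<theta> - T))"
      by simp
  qed
qed

text \<open>The first bound is the estimate started at \<open>\<theta>0\<close>. For the second one, any numbers exceeding the
  two upper limits are valid bounds on the sides and for the right-hand sides beyond some angle
  \<open>T\<close>; the estimate started at \<open>T\<close> then passes to the limit. Both upper limits are finite, so the
  excess can be sent to zero in real arithmetic.\<close>
lemma stability_estimates:
  "\<exists>C>0. \<exists>\<nu>>0. \<exists>K1>0. \<forall>f1 f2 u1 u2 :: real^2 \<Rightarrow> real.
    bounded (f1 ` U) \<and> bounded (f2 ` U) \<and>
    C2_on U u1 \<and> C2_on U u2 \<and> continuous_on U' u1 \<and> continuous_on U' u2 \<and>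
    below_exp_growth r1 r2 u1 \<and> below_exp_growth r1 r2 u2 \<and>
    bounded (u1 ` \<gamma>) \<and> bounded (u2 ` \<gamma>) \<and>
    (\<forall>x\<in>U. elliptic_op A b u1 x = f1 x) \<and> (\<forall>x\<in>U. elliptic_op A b u2 x = f2 x)
    \<longrightarrow>
    (\<forall>\<theta>\<ge>\<theta>0. (SUP x\<in>S \<theta>. \<bar>u1 x - u2 x\<bar>) \<le>
        (1 + C) * (SUP x\<in>\<gamma>. \<bar>u1 x - u2 x\<bar>)
        + K1 * (1 + C) * (SUP x\<in>U. \<bar>f1 x - f2 x\<bar>)
        + C * (SUP x\<in>S \<theta>0. \<bar>u1 x - u2 x\<bar>) * exp (- \<nu> * (\<theta> - \<theta>0))) \<and>
    Limsup at_top (\<lambda>\<theta>. ereal (SUP x\<in>S \<theta>. \<bar>u1 x - u2 x\<bar>)) \<le>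
      Limsup at_top (\<lambda>\<theta>. ereal (SUP x\<in>\<gamma> \<inter> S \<theta>. \<bar>u1 x - u2 x\<bar>))
      + ereal K1 * Limsup at_top (\<lambda>\<theta>. ereal (SUP x\<in>U \<inter> S \<theta>. \<bar>f1 x - f2 x\<bar>))"
proof -
  define K where "K = 2 / \<delta>"
  have nK: "0 < \<nu>" "0 < K" using c by (simp_all add: K_def)
  note est = two_sided_estimate[folded K_def]
  show ?thesis
  proof (rule exI[of _ 2], rule conjI, simp, rule exI[of _ \<nu>], rule conjI, rule nK(1),
      rule exI[of _ K], rule conjI, rule nK(2), intro allI impI, elim conjE, intro conjI allI impI)
    fix f1 f2 u1 u2 :: "real^2 \<Rightarrow> real"
    assume f: "bounded (f1 ` U)" "bounded (f2 ` U)"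
      and u: "C2_on U u1" "C2_on U u2" "continuous_on U' u1" "continuous_on U' u2"
        "below_exp_growth r1 r2 u1" "below_exp_growth r1 r2 u2"
      and \<gamma>: "bounded (u1 ` \<gamma>)" "bounded (u2 ` \<gamma>)"
      and L: "\<forall>x\<in>U. elliptic_op A b u1 x = f1 x" "\<forall>x\<in>U. elliptic_op A b u2 x = f2 x"
    define v where "v x = \<bar>u1 x - u2 x\<bar>" for x
    define f where "f x = \<bar>f1 x - f2 x\<bar>" for x
    have bdd: "bdd_above (v ` \<gamma>)" "bdd_above (f ` U)"
      using bdd_above_abs_diff[OF \<gamma>] bdd_above_abs_diff[OF f] by (simp_all add: v_def f_def)
    have bdd_S: "bdd_above (v ` S \<theta>)" if "\<theta>0 \<le> \<theta>" for \<theta>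
      using bdd_above_section[OF continuous_on_diff[OF u(3,4)] that] by (simp add: v_def)
    have v0: "0 \<le> v x" and f0: "0 \<le> f x" for x by (simp_all add: v_def f_def)
    define m where "m = (SUP x\<in>\<gamma>. v x)"
    define F where "F = (SUP x\<in>U. f x)"
    have m: "v x \<le> m" if "x \<in> \<gamma>" for x unfolding m_def by (rule cSUP_upper[OF that bdd(1)])
    have F: "f x \<le> F" if "x \<in> U" for x unfolding F_def by (rule cSUP_upper[OF that bdd(2)])
    have n: "v (polar r \<theta>) \<le> (SUP x\<in>S \<theta>. v x)" if "\<theta>0 \<le> \<theta>" "r1 \<theta> \<le> r" "r \<le> r2 \<theta>" for r \<theta>
      by (rule cSUP_upper[OF in_S bdd_S]) (use that in auto)
    have mid: "polar ((r1 \<theta> + r2 \<theta>) / 2) \<theta> \<in> U \<inter> S \<theta>" if "\<theta>0 < \<theta>" for \<theta>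
      using less[of \<theta>] that by (auto intro: in_U in_S)
    have side: "polar (r1 \<theta>) \<theta> \<in> \<gamma> \<inter> S \<theta>" "polar (r2 \<theta>) \<theta> \<in> \<gamma> \<inter> S \<theta>" if "\<theta>0 \<le> \<theta>" for \<theta>
      using less[of \<theta>] that by (auto intro: in_sides in_S)
    have m0: "0 \<le> m" using order_trans[OF v0 m] side(1)[of \<theta>0] by blast
    have F0: "0 \<le> F" using order_trans[OF f0 F] mid[of "\<theta>0 + 1"] by force
    have n0: "0 \<le> (SUP x\<in>S \<theta>. v x)" if "\<theta>0 \<le> \<theta>" for \<theta>
      using order_trans[OF v0 n[OF that]] less[OF that] by force
    have est': "(SUP x\<in>S \<theta>. v x) \<le> m + K * F + 2 * (SUP x\<in>S T. v x) * exp (- \<nu> * (\<theta> - T))"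
      if "\<theta>0 \<le> T" "T \<le> \<theta>" "0 \<le> m" "0 \<le> F"
        and "\<And>\<theta>. T \<le> \<theta> \<Longrightarrow> v (polar (r1 \<theta>) \<theta>) \<le> m \<and> v (polar (r2 \<theta>) \<theta>) \<le> m"
        and "\<And>r \<theta>. \<lbrakk>T < \<theta>; r1 \<theta> < r; r < r2 \<theta>\<rbrakk> \<Longrightarrow> f (polar r \<theta>) \<le> F"
      for T \<theta> m F
      unfolding v_def
    proof (rule est[OF u])
      show "0 \<le> (SUP x\<in>S T. \<bar>u1 x - u2 x\<bar>)" using n0[OF that(1)] by (simp add: v_def)
      show "\<bar>u1 (polar r T) - u2 (polar r T)\<bar> \<le> (SUP x\<in>S T. \<bar>u1 x - u2 x\<bar>)"
        if "r1 T \<le> r" "r \<le> r2 T" for r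
        using n[OF \<open>\<theta>0 \<le> T\<close> that] by (simp add: v_def)
      show "\<bar>elliptic_op A b u1 (polar r \<theta>) - elliptic_op A b u2 (polar r \<theta>)\<bar> \<le> F"
        if "T < \<theta>" "r1 \<theta> < r" "r < r2 \<theta>" for r \<theta>
      proof -
        have "polar r \<theta> \<in> U" using that \<open>\<theta>0 \<le> T\<close> by (intro in_U) auto
        then show ?thesis using L \<open>\<And>r \<theta>. \<lbrakk>T < \<theta>; r1 \<theta> < r; r < r2 \<theta>\<rbrakk> \<Longrightarrow> f (polar r \<theta>) \<le> F\<close>[OF that]
          by (simp add: f_def)
      qed
    qed (use that(1-4) that(5)[unfolded v_def] in blast)+
    {
      fix \<theta> assume \<theta>: "\<theta>0 \<le> \<theta>"
      have "(SUP x\<in>S \<theta>. v x) \<le> m + K * F + 2 * (SUP x\<in>S \<theta>0. v x) * exp (- \<nu> * (\<theta> - \<theta>0))"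
      proof (rule est'[OF order_refl \<theta> m0 F0])
        show "v (polar (r1 \<theta>) \<theta>) \<le> m \<and> v (polar (r2 \<theta>) \<theta>) \<le> m" if "\<theta>0 \<le> \<theta>" for \<theta>
          using m side[OF that] by blast
        show "f (polar r \<theta>) \<le> F" if "\<theta>0 < \<theta>" "r1 \<theta> < r" "r < r2 \<theta>" for r \<theta>
          using that by (intro F in_U)
      qed
      also have "\<dots> \<le> (1 + 2) * m + K * (1 + 2) * F + 2 * (SUP x\<in>S \<theta>0. v x) * exp (- \<nu> * (\<theta> - \<theta>0))"
      proof -
        have "0 \<le> K * F" using nK F0 by simp
        with m0 have "m + K * F \<le> 3 * m + 3 * (K * F)" by linarith
        also have "\<dots> = (1 + 2) * m + K * (1 + 2) * F" by simp
        finally show ?thesis by (rule add_right_mono)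
      qed
      finally show "(SUP x\<in>S \<theta>. \<bar>u1 x - u2 x\<bar>) \<le> (1 + 2) * (SUP x\<in>\<gamma>. \<bar>u1 x - u2 x\<bar>)
         + K * (1 + 2) * (SUP x\<in>U. \<bar>f1 x - f2 x\<bar>)
         + 2 * (SUP x\<in>S \<theta>0. \<bar>u1 x - u2 x\<bar>) * exp (- \<nu> * (\<theta> - \<theta>0))"
        by (simp only: v_def f_def m_def F_def)
    }
    define g where "g \<theta> = (SUP x\<in>\<gamma> \<inter> S \<theta>. v x)" for \<theta>
    define h where "h \<theta> = (SUP x\<in>U \<inter> S \<theta>. f x)" for \<theta>
    have g_upper: "v x \<le> g \<theta>" if "x \<in> \<gamma> \<inter> S \<theta>" for x \<theta>
      unfolding g_def using that by (intro cSUP_upper bdd_above_mono[OF bdd(1)]) auto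
    have h_upper: "f x \<le> h \<theta>" if "x \<in> U \<inter> S \<theta>" for x \<theta>
      unfolding h_def using that by (intro cSUP_upper bdd_above_mono[OF bdd(2)]) auto
    have g: "0 \<le> g \<theta> \<and> g \<theta> \<le> m" if "\<theta>0 < \<theta>" for \<theta>
    proof
      show "0 \<le> g \<theta>" using order_trans[OF v0 g_upper[OF side(1)]] that by simp
      show "g \<theta> \<le> m" unfolding g_def using side(1)[of \<theta>] that m by (intro cSUP_least) auto
    qed
    have h: "0 \<le> h \<theta> \<and> h \<theta> \<le> F" if "\<theta>0 < \<theta>" for \<theta>
    proof
      show "0 \<le> h \<theta>" by (rule order_trans[OF f0 h_upper[OF mid[OF that]]])
      show "h \<theta> \<le> F" unfolding h_def using mid[OF that] F by (intro cSUP_least) auto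
    qed
    define a where "a = real_of_ereal (Limsup at_top (\<lambda>\<theta>. ereal (g \<theta>)))"
    define d where "d = real_of_ereal (Limsup at_top (\<lambda>\<theta>. ereal (h \<theta>)))"
    have a: "Limsup at_top (\<lambda>\<theta>. ereal (g \<theta>)) = ereal a" "0 \<le> a"
      and d: "Limsup at_top (\<lambda>\<theta>. ereal (h \<theta>)) = ereal d" "0 \<le> d"
    proof -
      have *: "Limsup at_top (\<lambda>\<theta>. ereal (k \<theta>)) = ereal (real_of_ereal (Limsup at_top (\<lambda>\<theta>. ereal (k \<theta>)))) \<and>
          0 \<le> real_of_ereal (Limsup at_top (\<lambda>\<theta>. ereal (k \<theta>)))"
        if k: "\<And>\<theta>. \<theta>0 < \<theta> \<Longrightarrow> 0 \<le> k \<theta> \<and> k \<theta> \<le> B" for k :: "real \<Rightarrow> real" and B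
      proof -
        have "0 \<le> Limsup at_top (\<lambda>\<theta>. ereal (k \<theta>))"
          by (rule le_Limsup) (auto intro!: eventually_mono[OF eventually_gt_at_top[of \<theta>0]] dest: k)
        moreover have "Limsup at_top (\<lambda>\<theta>. ereal (k \<theta>)) \<le> ereal B"
          by (rule Limsup_bounded) (auto intro!: eventually_mono[OF eventually_gt_at_top[of \<theta>0]] dest: k)
        ultimately show ?thesis by (cases "Limsup at_top (\<lambda>\<theta>. ereal (k \<theta>))") auto
      qed
      show "Limsup at_top (\<lambda>\<theta>. ereal (g \<theta>)) = ereal a" "0 \<le> a" using *[of g m] g by (auto simp: a_def)
      show "Limsup at_top (\<lambda>\<theta>. ereal (h \<theta>)) = ereal d" "0 \<le> d" using *[of h F] h by (auto simp: d_def)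
    qed
    have step: "Limsup at_top (\<lambda>\<theta>. ereal (SUP x\<in>S \<theta>. v x)) \<le> ereal ((a + e) + K * (d + e))" if e: "e > 0" for e
    proof -
      have "\<forall>\<^sub>F \<theta> in at_top. ereal (g \<theta>) < ereal (a + e)" "\<forall>\<^sub>F \<theta> in at_top. ereal (h \<theta>) < ereal (d + e)"
        by (rule Limsup_lessD, use a d e in simp)+
      then have "\<forall>\<^sub>F \<theta> in at_top. g \<theta> < a + e \<and> h \<theta> < d + e \<and> \<theta>0 \<le> \<theta>"
        using eventually_ge_at_top[of \<theta>0] by eventually_elim simp
      then obtain T where T: "\<forall>\<theta>\<ge>T. g \<theta> < a + e \<and> h \<theta> < d + e \<and> \<theta>0 \<le> \<theta>"
        unfolding eventually_at_top_linorder by blast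
      have ev: "(SUP x\<in>S \<theta>. v x) \<le> (a + e) + K * (d + e) + 2 * (SUP x\<in>S T. v x) * exp (- \<nu> * (\<theta> - T))"
        if "T \<le> \<theta>" for \<theta>
      proof (rule est')
        show "\<theta>0 \<le> T" "T \<le> \<theta>" "0 \<le> a + e" "0 \<le> d + e" using T that a d e by auto
        show "v (polar (r1 \<theta>) \<theta>) \<le> a + e \<and> v (polar (r2 \<theta>) \<theta>) \<le> a + e" if "T \<le> \<theta>" for \<theta>
          using g_upper[OF side(1), of \<theta>] g_upper[OF side(2), of \<theta>] T that by force
        show "f (polar r \<theta>) \<le> d + e" if "T < \<theta>" "r1 \<theta> < r" "r < r2 \<theta>" for r \<theta>
        proof -
          have "\<theta>0 \<le> T" using T by simp
          then have "polar r \<theta> \<in> U \<inter> S \<theta>" using that by (auto intro: in_U in_S)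
          then have "f (polar r \<theta>) \<le> h \<theta>" by (rule h_upper)
          then show ?thesis using T that by (meson less_imp_le order_trans)
        qed
      qed
      have "filterlim (\<lambda>\<theta>. - T + \<theta>) at_top at_top"
        by (rule filterlim_tendsto_add_at_top[OF tendsto_const filterlim_ident])
      then have "filterlim (\<lambda>\<theta>. \<nu> * (- T + \<theta>)) at_top at_top"
        by (rule filterlim_tendsto_pos_mult_at_top[OF tendsto_const nK(1)])
      then have "((\<lambda>\<theta>. exp (- (\<nu> * (- T + \<theta>)))) \<longlongrightarrow> 0) at_top"
        by (intro filterlim_compose[OF exp_at_bot] filterlim_compose[OF filterlim_uminus_at_bot_at_top])
      then have "((\<lambda>\<theta>. exp (- \<nu> * (\<theta> - T))) \<longlongrightarrow> 0) at_top" by (simp add: algebra_simps)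
      then have "((\<lambda>\<theta>. (a + e) + K * (d + e) + 2 * (SUP x\<in>S T. v x) * exp (- \<nu> * (\<theta> - T)))
          \<longlongrightarrow> (a + e) + K * (d + e) + 2 * (SUP x\<in>S T. v x) * 0) at_top"
        by (intro tendsto_intros)
      then have lim: "Limsup at_top (\<lambda>\<theta>. ereal ((a + e) + K * (d + e) + 2 * (SUP x\<in>S T. v x) * exp (- \<nu> * (\<theta> - T))))
          = ereal ((a + e) + K * (d + e))"
        by (intro lim_imp_Limsup) auto
      show ?thesis unfolding lim[symmetric]
        by (rule Limsup_mono, rule eventually_mono[OF eventually_ge_at_top[of T]]) (use ev in simp)
    qed
    have "Limsup at_top (\<lambda>\<theta>. ereal (SUP x\<in>S \<theta>. v x)) \<le> ereal (a + K * d)"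
    proof (rule ereal_le_epsilon2)
      fix e :: real assume "e > 0"
      define e' where "e' = e / (1 + K)"
      have "1 + K > 0" using nK by simp
      then have "e' > 0" "(1 + K) * e' = e" using \<open>e > 0\<close> by (simp_all add: e'_def)
      then have eq: "(a + e') + K * (d + e') = a + K * d + e" by (simp add: algebra_simps)
      show "Limsup at_top (\<lambda>\<theta>. ereal (SUP x\<in>S \<theta>. v x)) \<le> ereal (a + K * d) + ereal e"
        using step[OF \<open>e' > 0\<close>] unfolding eq by simp
    qed
    then show "Limsup at_top (\<lambda>\<theta>. ereal (SUP x\<in>S \<theta>. \<bar>u1 x - u2 x\<bar>)) \<le>
      Limsup at_top (\<lambda>\<theta>. ereal (SUP x\<in>\<gamma> \<inter> S \<theta>. \<bar>u1 x - u2 x\<bar>))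
      + ereal K * Limsup at_top (\<lambda>\<theta>. ereal (SUP x\<in>U \<inter> S \<theta>. \<bar>f1 x - f2 x\<bar>))"
      using a(1) d(1) by (simp add: g_def h_def v_def f_def)
  qed
qed

end

theorem theorem6p2:
  fixes \<theta>0 rs c0 M1 M2 :: real
    and r1 r2 :: "real \<Rightarrow> real"
    and A :: "real^2 \<Rightarrow> real^2^2"
    and b :: "real^2 \<Rightarrow> real^2"
    and U U' \<gamma> :: "(real^2) set"
    and S :: "real \<Rightarrow> (real^2) set"
  defines "U \<equiv> spiral_domain \<theta>0 r1 r2"
    and "U' \<equiv> spiral_closed \<theta>0 r1 r2"
    and "\<gamma> \<equiv> spiral_sides \<theta>0 r1 r2"
    and "S \<equiv> spiral_section r1 r2"
  assumes "continuous_on {\<theta>0..} r1" and "continuous_on {\<theta>0..} r2"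
    and "\<And>\<theta>. \<theta> \<ge> \<theta>0 \<Longrightarrow> r1 \<theta> > 0" and "\<And>\<theta>. \<theta> \<ge> \<theta>0 \<Longrightarrow> r2 \<theta> > 0"
    and "\<And>\<theta>. \<theta> \<ge> \<theta>0 \<Longrightarrow> r2 (\<theta> + 2 * pi) < r1 \<theta>"
    and "\<And>\<theta>. \<theta> \<ge> \<theta>0 \<Longrightarrow> r1 \<theta> < r2 \<theta>"
    and "rs > 0" and "(r1 \<longlongrightarrow> rs) at_top" and "(r2 \<longlongrightarrow> rs) at_top"
    and "\<And>x. x \<in> U \<Longrightarrow> transpose (A x) = A x"
    and "c0 > 0" and "M1 > 0"
    and "\<And>x \<xi>. x \<in> U \<Longrightarrow> \<xi> \<bullet> (A x *v \<xi>) \<ge> c0 * (norm \<xi>)\<^sup>2"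
    and "\<And>x. x \<in> U \<Longrightarrow> trace (A x) \<le> M1"
    and "M2 \<ge> 0" and "\<And>x. x \<in> U \<Longrightarrow> norm (b x) \<le> M2"
  shows "\<exists>C>0. \<exists>\<nu>>0. \<exists>K1>0. \<forall>f1 f2 u1 u2 :: real^2 \<Rightarrow> real.
    bounded (f1 ` U) \<and> bounded (f2 ` U) \<and>
    C2_on U u1 \<and> C2_on U u2 \<and> continuous_on U' u1 \<and> continuous_on U' u2 \<and>
    below_exp_growth r1 r2 u1 \<and> below_exp_growth r1 r2 u2 \<and>
    bounded (u1 ` \<gamma>) \<and> bounded (u2 ` \<gamma>) \<and>
    (\<forall>x\<in>U. elliptic_op A b u1 x = f1 x) \<and> (\<forall>x\<in>U. elliptic_op A b u2 x = f2 x)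
    \<longrightarrow>
    (\<forall>\<theta>\<ge>\<theta>0. (SUP x\<in>S \<theta>. \<bar>u1 x - u2 x\<bar>) \<le>
        (1 + C) * (SUP x\<in>\<gamma>. \<bar>u1 x - u2 x\<bar>)
        + K1 * (1 + C) * (SUP x\<in>U. \<bar>f1 x - f2 x\<bar>)
        + C * (SUP x\<in>S \<theta>0. \<bar>u1 x - u2 x\<bar>) * exp (- \<nu> * (\<theta> - \<theta>0))) \<and>
    Limsup at_top (\<lambda>\<theta>. ereal (SUP x\<in>S \<theta>. \<bar>u1 x - u2 x\<bar>)) \<le>
      Limsup at_top (\<lambda>\<theta>. ereal (SUP x\<in>\<gamma> \<inter> S \<theta>. \<bar>u1 x - u2 x\<bar>))
      + ereal K1 * Limsup at_top (\<lambda>\<theta>. ereal (SUP x\<in>U \<inter> S \<theta>. \<bar>f1 x - f2 x\<bar>))"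
proof -
  have "spiral_operator \<theta>0 rs r1 r2 A b c0 M1 M2"
    using assms by unfold_locales (auto simp: U_def)
  then obtain \<alpha> \<delta> \<nu> R where "spiral_barrier \<theta>0 rs r1 r2 A b c0 M1 M2 \<alpha> \<delta> \<nu> R"
    by (rule spiral_operator.obtain_barrier)
  from spiral_barrier.stability_estimates[OF this]
  show ?thesis unfolding U_def U'_def \<gamma>_def S_def .
qed

end
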